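(* Let $\mu$ be a probability measure on $\mathbb{R}^n$ with density $e^{-V}$, where $V:\mathbb{R}^n\to\mathbb{R}$ is a $\mathcal C^2$ function satisfying $\mathrm{Hess}(V)>0$. Then $$\mathrm{Var}_\mu(f)\le\int\nabla f\cdot\mathrm{Hess}(V)^{-1}\nabla f\,d\mu-\frac{\Big(\int Vf\,d\mu-\int V\,d\mu\int f\,d\mu\Big)^2}{n-\mathrm{Var}_\mu(V)}$$ for all $\mathcal C^1$ compactly supported functions $f$ on $\mathbb{R}^n$.
   Context: Densities are with respect to Lebesgue measure. $\mathrm{Hess}(V)>0$ means that the Hessian matrix is positive definite at every point. $\mathrm{Var}_\mu(f)=\int f^2d\mu-\big(\int f\,d\mu\big)^2$. *)

theory Defs
  imports "HOL-Probability.Probability"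
begin

definition gradient :: "(real ^ 'n \<Rightarrow> real) \<Rightarrow> real ^ 'n \<Rightarrow> real ^ 'n" where
  "gradient f x = (\<chi> i. frechet_derivative f (at x) (axis i 1))"

text \<open>The entry \<open>(i, j)\<close> is the \<open>j\<close>-th partial derivative of the \<open>i\<close>-th
  partial derivative.\<close>

definition hessian :: "(real ^ 'n \<Rightarrow> real) \<Rightarrow> real ^ 'n \<Rightarrow> real ^ 'n ^ 'n" where
  "hessian f x = jacobian (gradient f) (at x)"

text \<open>\<^const>\<open>gradient\<close> and \<^const>\<open>hessian\<close> are total functions and only meaningful where
  the derivatives exist, so differentiability is required explicitly here.\<close>

definition C1 :: "(real ^ 'n \<Rightarrow> real) \<Rightarrow> bool" where
  "C1 f \<longleftrightarrow> f differentiable_on UNIV \<and> continuous_on UNIV (gradient f)"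

definition C2 :: "(real ^ 'n \<Rightarrow> real) \<Rightarrow> bool" where
  "C2 f \<longleftrightarrow> C1 f \<and> gradient f differentiable_on UNIV \<and> continuous_on UNIV (hessian f)"

definition compactly_supported :: "(real ^ 'n \<Rightarrow> real) \<Rightarrow> bool" where
  "compactly_supported f \<longleftrightarrow> compact (closure {x. f x \<noteq> 0})"

text \<open>Symmetry is not part of this definition: it is only used for Hessians of
  \<^const>\<open>C2\<close> functions, which are symmetric.\<close>

definition positive_definite :: "real ^ 'n ^ 'n \<Rightarrow> bool" where
  "positive_definite A \<longleftrightarrow> (\<forall>x. x \<noteq> 0 \<longrightarrow> x \<bullet> (A *v x) > 0)"

definition Var :: "'a measure \<Rightarrow> ('a \<Rightarrow> real) \<Rightarrow> real" where
  "Var M f = (\<integral>x. (f x)\<^sup>2 \<partial>M) - (\<integral>x. f x \<partial>M)\<^sup>2"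

end

theory Submission
  imports Defs
begin

text \<open>
  This is a dimensional refinement of the Brascamp-Lieb variance inequality. Write \<open>q\<close> for
  the dual form \<open>gradient f \<bullet> (matrix_inv (hessian V) *v gradient f)\<close>, \<open>Q\<close> for its integral, \<open>n\<close> for
  the dimension and \<open>C\<close> for the covariance of \<open>V\<close> and \<open>f\<close>. The theorem follows from the
  family of inequalities \<open>Var (f + c V) - n * c\<^sup>2 \<le> Q\<close>, one for each real \<open>c\<close>
  (\<open>brascamp_lieb_quadratic\<close>). They read \<open>Var f + 2 * c * C - c\<^sup>2 * (n - Var V) \<le> Q\<close>; if
  \<open>n > Var V\<close>, the left-hand side is largest at \<open>c = C / (n - Var V)\<close>, and otherwise \<open>c = 0\<close> suffices.

  To prove such an inequality, perturb \<open>V\<close> in two ways at once: dilate it to the perspective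
  \<open>s * V (y / s)\<close> with \<open>s = 1 + c * \<delta>\<close>, and add \<open>\<delta> * f (y / s)\<close>. The perspective is jointly convex
  in \<open>s\<close> and \<open>y\<close>, so the average of the perturbed functions for \<open>\<delta>\<close> and \<open>- \<delta>\<close> at two points is at
  least \<open>V\<close> at the midpoint of the points, up to a loss caused by \<open>f\<close>. To second order it is
  bounded by minimizing, over the displacement of the two points, a quadratic form given by the
  Hessian plus a linear form given by the gradient; the minimum is \<open>- \<delta>\<^sup>2 * q / 2\<close>
  (\<open>perturbed_midpoint_convexity\<close>). The error is uniform in
  the points although the Hessian of \<open>V\<close> has no uniform lower bound: the loss occurs only when one
  of the points lies in the compact support of \<open>f\<close>.

  The midpoint case of the Prekopa-Leindler inequality (\<open>prekopa_leindler\<close>) turns this pointwise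
  estimate into one between integrals. Dilations contribute the factor
  \<open>((1 + c * \<delta>) * (1 - c * \<delta>)) ^ n\<close>, hence the term \<open>n * c\<^sup>2\<close>, and the remaining integrals are exponential
  moments of \<open>\<plusminus> \<delta> * (f + c V)\<close>, hence the variance. Comparing the coefficients of \<open>\<delta>\<^sup>2\<close> gives the
  family above. A cubic lower bound of the exponential suffices for the comparison, so that
  only moments up to order three of \<open>V\<close> are needed; these are finite since \<open>V\<close> is convex and \<open>exp (- V)\<close> is
  integrable.

  Prekopa-Leindler itself is proved by induction over the coordinates from the real line,
  where it is the layer-cake integral of the Brunn-Minkowski inequality.
\<close>

section \<open>The midpoint inequality of Prekopa and Leindler\<close>

lemma emeasure_lborel_translate:
  fixes A :: "real set"
  assumes [measurable]: "A \<in> sets borel"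
  shows "emeasure lborel {x. x - t \<in> A} = emeasure lborel A"
proof -
  have "emeasure lborel {x. x - t \<in> A} = (\<integral>\<^sup>+x. indicator {x. x - t \<in> A} (t + 1 * x) \<partial>lborel)"
    using nn_integral_real_affine[of "indicator {x. x - t \<in> A}" 1 t] by simp
  also have "\<dots> = (\<integral>\<^sup>+x. indicator A x \<partial>lborel)"
    by (intro nn_integral_cong) (auto simp: indicator_def)
  finally show ?thesis by simp
qed

text \<open>
  Translate \<open>A\<close> by a point \<open>b\<close> near the bottom of \<open>B\<close>, and \<open>B\<close> by a point \<open>a\<close> near the
  top of \<open>A\<close>. Up to an error \<open>e\<close> the two translates lie on either side of \<open>a + b\<close>, so their
  measures add up, and both lie in the doubled set \<open>C\<close>.
\<close>

lemma brunn_minkowski_real_bounded: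
  fixes A B C :: "real set"
  assumes [measurable]: "A \<in> sets borel" "B \<in> sets borel" "C \<in> sets borel"
    and ne: "A \<noteq> {}" "B \<noteq> {}"
    and bdd: "bdd_above A" "bdd_below B"
    and mid: "\<And>a b. a \<in> A \<Longrightarrow> b \<in> B \<Longrightarrow> (a + b) / 2 \<in> C"
  shows "emeasure lborel A + emeasure lborel B \<le> 2 * emeasure lborel C"
proof (rule ennreal_le_epsilon)
  fix e :: real assume e: "0 < e"
  obtain a where a: "a \<in> A" "Sup A - e / 2 < a"
    using less_cSupD[OF ne(1), of "Sup A - e / 2"] e by auto
  obtain b where b: "b \<in> B" "b < Inf B + e / 2"
    using cInf_lessD[OF ne(2), of "Inf B + e / 2"] e by auto
  \<comment> \<open>The half-open choice makes the two translates disjoint at \<open>a + b\<close>.\<close>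
  define A1 where "A1 = {x. x - b \<in> A \<inter> {..<a}}"
  define B1 where "B1 = {x. x - a \<in> B \<inter> {b..}}"
  have [measurable]: "A1 \<in> sets borel" "B1 \<in> sets borel"
    unfolding A1_def B1_def by measurable
  have disj: "A1 \<inter> B1 = {}" by (auto simp: A1_def B1_def)
  have sub: "A1 \<union> B1 \<subseteq> {x. x / 2 \<in> C}"
    using mid[of "_ - b" b] mid[of a "_ - a"] a(1) b(1) by (auto simp: A1_def B1_def)
  have dbl: "emeasure lborel {x. x / 2 \<in> C} = 2 * emeasure lborel C"
  proof -
    have "emeasure lborel {x. x / 2 \<in> C} = 2 * (\<integral>\<^sup>+x. indicator {x. x / 2 \<in> C} (0 + 2 * x) \<partial>lborel)"
      using nn_integral_real_affine[of "indicator {x. x / 2 \<in> C}" 2 0] by simp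
    also have "(\<integral>\<^sup>+x. indicator {x. x / 2 \<in> C} (0 + 2 * x) \<partial>lborel) = (\<integral>\<^sup>+x. indicator C x \<partial>lborel)"
      by (intro nn_integral_cong) (auto simp: indicator_def)
    finally show ?thesis by simp
  qed
  have eA: "emeasure lborel A \<le> emeasure lborel A1 + e / 2"
  proof -
    have "emeasure lborel A \<le> emeasure lborel ((A \<inter> {..<a}) \<union> {a .. a + e / 2})"
      using a(2) cSup_upper[OF _ bdd(1)] by (intro emeasure_mono) (force simp: not_less)+
    also have "\<dots> \<le> emeasure lborel (A \<inter> {..<a}) + emeasure lborel {a .. a + e / 2}"
      by (rule emeasure_subadditive) auto
    also have "emeasure lborel (A \<inter> {..<a}) = emeasure lborel A1"
      unfolding A1_def by (rule emeasure_lborel_translate[symmetric]) auto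
    finally show ?thesis using e by simp
  qed
  have eB: "emeasure lborel B \<le> emeasure lborel B1 + e / 2"
  proof -
    have "emeasure lborel B \<le> emeasure lborel ((B \<inter> {b..}) \<union> {b - e / 2 .. b})"
      using b(2) cInf_lower[OF _ bdd(2)] by (intro emeasure_mono) (force simp: not_less)+
    also have "\<dots> \<le> emeasure lborel (B \<inter> {b..}) + emeasure lborel {b - e / 2 .. b}"
      by (rule emeasure_subadditive) auto
    also have "emeasure lborel (B \<inter> {b..}) = emeasure lborel B1"
      unfolding B1_def by (rule emeasure_lborel_translate[symmetric]) auto
    finally show ?thesis using e by simp
  qed
  have "emeasure lborel A + emeasure lborel B
      \<le> (emeasure lborel A1 + e / 2) + (emeasure lborel B1 + e / 2)"
    by (rule add_mono[OF eA eB])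
  also have "\<dots> = emeasure lborel (A1 \<union> B1) + e"
    using e disj by (subst plus_emeasure[symmetric]) (auto simp: ac_simps simp flip: ennreal_plus)
  also have "emeasure lborel (A1 \<union> B1) \<le> 2 * emeasure lborel C"
    unfolding dbl[symmetric] by (rule emeasure_mono[OF sub]) measurable
  finally show "emeasure lborel A + emeasure lborel B \<le> 2 * emeasure lborel C + e"
    by (simp add: add_right_mono)
qed

lemma brunn_minkowski_real:
  fixes A B C :: "real set"
  assumes [measurable]: "A \<in> sets borel" "B \<in> sets borel" "C \<in> sets borel"
    and ne: "A \<noteq> {}" "B \<noteq> {}"
    and mid: "\<And>a b. a \<in> A \<Longrightarrow> b \<in> B \<Longrightarrow> (a + b) / 2 \<in> C"
  shows "emeasure lborel A + emeasure lborel B \<le> 2 * emeasure lborel C"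
proof -
  obtain a b where ab: "a \<in> A" "b \<in> B" using ne by auto
  define A' where "A' k = A \<inter> {.. a + real k}" for k
  define B' where "B' k = B \<inter> {b - real k ..}" for k
  have [measurable]: "A' k \<in> sets borel" "B' k \<in> sets borel" for k
    by (auto simp: A'_def B'_def)
  have le: "emeasure lborel (A' k) + emeasure lborel (B' k) \<le> 2 * emeasure lborel C" for k
    by (rule brunn_minkowski_real_bounded) 
      (use ab mid in \<open>auto simp: A'_def B'_def intro: bdd_above_Int2 bdd_below_Int2\<close>)
  have UA: "(\<Union>k. A' k) = A"
  proof safe
    fix x assume "x \<in> A"
    moreover obtain k where "x - a \<le> real k" using real_arch_simple by blast
    ultimately show "x \<in> (\<Union>k. A' k)" by (auto simp: A'_def algebra_simps intro!: exI[of _ k])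
  qed (auto simp: A'_def)
  have UB: "(\<Union>k. B' k) = B"
  proof safe
    fix x assume "x \<in> B"
    moreover obtain k where "b - x \<le> real k" using real_arch_simple by blast
    ultimately show "x \<in> (\<Union>k. B' k)" by (auto simp: B'_def algebra_simps intro!: exI[of _ k])
  qed (auto simp: B'_def)
  have incA: "incseq A'" and incB: "incseq B'"
    by (force simp: A'_def B'_def incseq_def)+
  have "(\<lambda>k. emeasure lborel (A' k) + emeasure lborel (B' k))
      \<longlonglongrightarrow> emeasure lborel A + emeasure lborel B"
    using Lim_emeasure_incseq[OF _ incA, of lborel] Lim_emeasure_incseq[OF _ incB, of lborel]
    by (intro tendsto_add) (auto simp: UA UB image_subset_iff)
  then show ?thesis
    by (rule LIMSEQ_le_const2) (use le in auto)
qed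

lemma emeasure_lborel_greaterThan: "emeasure lborel {a::real<..} = \<infinity>"
proof (rule ccontr)
  assume "emeasure lborel {a<..} \<noteq> \<infinity>"
  then obtain r where r: "0 \<le> r" "emeasure lborel {a<..} = ennreal r"
    by (cases "emeasure lborel {a<..}") auto
  have "emeasure lborel {a<..<a + (r + 1)} \<le> emeasure lborel {a<..}"
    by (rule emeasure_mono) auto
  then show False using r by (simp add: ennreal_le_iff)
qed

text \<open>
  Tonelli's theorem for the region between the graph of \<open>f\<close> and the axis. The level \<open>t\<close>
  is a real number even though \<open>f\<close> may take the value \<open>\<infinity>\<close>.
\<close>

lemma nn_integral_layer_cake:
  fixes f :: "real \<Rightarrow> ennreal"
  assumes [measurable]: "f \<in> borel_measurable borel"
  shows "(\<integral>\<^sup>+x. f x \<partial>lborel) = (\<integral>\<^sup>+t. indicator {0<..} t * emeasure lborel {x. ennreal t < f x} \<partial>lborel)"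
proof -
  have eq: "f x = (\<integral>\<^sup>+t. indicator {t. 0 < t \<and> ennreal t < f x} t \<partial>lborel)" for x
  proof (cases "f x")
    case (real r)
    have "{t. 0 < t \<and> ennreal t < f x} = {0<..<r}" using real by (auto simp: ennreal_less_iff)
    then show ?thesis using real by simp
  next
    case top
    have "{t. 0 < t \<and> ennreal t < f x} = {0<..}" using top by auto
    then show ?thesis using top by (simp add: emeasure_lborel_greaterThan)
  qed
  have "(\<integral>\<^sup>+x. f x \<partial>lborel) =
      (\<integral>\<^sup>+x. (\<integral>\<^sup>+t. indicator {t. 0 < t \<and> ennreal t < f x} t \<partial>lborel) \<partial>lborel)"
    by (intro nn_integral_cong) (rule eq)
  also have "\<dots> =
      (\<integral>\<^sup>+x. (\<integral>\<^sup>+t. indicator {p. 0 < snd p \<and> ennreal (snd p) < f (fst p)} (x, t) \<partial>lborel) \<partial>lborel)"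
    by (intro nn_integral_cong) (auto simp: indicator_def)
  also have "\<dots> = (\<integral>\<^sup>+t. (\<integral>\<^sup>+x. indicator {p. 0 < snd p \<and> ennreal (snd p) < f (fst p)} (x, t) \<partial>lborel) \<partial>lborel)"
    by (rule lborel_pair.Fubini'[symmetric]) measurable
  also have "\<dots> = (\<integral>\<^sup>+t. indicator {0<..} t * emeasure lborel {x. ennreal t < f x} \<partial>lborel)"
  proof (rule nn_integral_cong)
    fix t :: real
    have "(\<integral>\<^sup>+x. indicator {p. 0 < snd p \<and> ennreal (snd p) < f (fst p)} (x, t) \<partial>lborel)
        = (\<integral>\<^sup>+x. indicator {0<..} t * indicator {x. ennreal t < f x} x \<partial>lborel)"
      by (auto intro!: nn_integral_cong simp: indicator_def)
    also have "\<dots> = indicator {0<..} t * emeasure lborel {x. ennreal t < f x}"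
      by (subst nn_integral_cmult) auto
    finally show "(\<integral>\<^sup>+x. indicator {p. 0 < snd p \<and> ennreal (snd p) < f (fst p)} (x, t) \<partial>lborel)
        = indicator {0<..} t * emeasure lborel {x. ennreal t < f x}" .
  qed
  finally show ?thesis .
qed

text \<open>
  When both suprema are 1, the superlevel sets of \<open>f\<close> and \<open>g\<close> are nonempty at exactly the
  levels below 1. There the midpoints of the two sets lie in the superlevel set of \<open>h\<close>,
  and the Brunn-Minkowski inequality can be integrated over the levels. The additive conclusion
  is stronger than the multiplicative one, by the inequality of the means.
\<close>

lemma prekopa_leindler_normalised:
  fixes f g h :: "real \<Rightarrow> ennreal"
  assumes [measurable]: "f \<in> borel_measurable borel" "g \<in> borel_measurable borel" "h \<in> borel_measurable borel"
    and sup: "(SUP x. f x) = 1" "(SUP x. g x) = 1"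
    and mid: "\<And>x y. f x * g y \<le> (h ((x + y) / 2))\<^sup>2"
  shows "(\<integral>\<^sup>+x. f x \<partial>lborel) + (\<integral>\<^sup>+x. g x \<partial>lborel) \<le> 2 * (\<integral>\<^sup>+x. h x \<partial>lborel)"
proof -
  have le1: "f x \<le> 1" "g x \<le> 1" for x
    using SUP_upper[of x UNIV f] SUP_upper[of x UNIV g] sup by auto
  have lev: "indicator {0<..} t * emeasure lborel {x. ennreal t < f x}
      + indicator {0<..} t * emeasure lborel {x. ennreal t < g x}
      \<le> 2 * (indicator {0<..} t * emeasure lborel {x. ennreal t < h x})" for t
  proof (cases "0 < t \<and> t < 1")
    case True
    have "\<exists>x. ennreal t < f x" "\<exists>x. ennreal t < g x"
      using True sup less_SUP_iff[of "ennreal t" f UNIV] less_SUP_iff[of "ennreal t" g UNIV] by auto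
    moreover have "ennreal t < h ((x + y) / 2)" if x: "ennreal t < f x" and y: "ennreal t < g y" for x y
    proof (rule ccontr)
      assume "\<not> ennreal t < h ((x + y) / 2)"
      then have "h ((x + y) / 2) \<le> ennreal t" by simp
      then have "(h ((x + y) / 2))\<^sup>2 \<le> (ennreal t)\<^sup>2" by (simp add: power_mono)
      then have 1: "f x * g y \<le> ennreal (t\<^sup>2)" using mid[of x y] True by (simp add: ennreal_power)
      obtain p where p: "0 \<le> p" "f x = ennreal p" using le1(1)[of x] by (cases "f x") (auto simp: top_unique)
      obtain q where q: "0 \<le> q" "g y = ennreal q" using le1(2)[of y] by (cases "g y") (auto simp: top_unique)
      have "p * q \<le> t\<^sup>2" using 1 p q by (simp flip: ennreal_mult)
      moreover have "t < p" "t < q" using x y p q True by (simp_all add: ennreal_less_iff)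
      ultimately show False
        using mult_strict_mono[of t p t q] True by (simp add: power2_eq_square)
    qed
    ultimately show ?thesis
      using brunn_minkowski_real[of "{x. ennreal t < f x}" "{x. ennreal t < g x}" "{x. ennreal t < h x}"] True
      by auto
  next
    case False
    have "{x. ennreal t < f x} = {}" "{x. ennreal t < g x} = {}" if "0 < t"
      using False that le1 by (auto simp: not_less intro: order_trans[of _ 1])
    then show ?thesis by (cases "0 < t") auto
  qed
  have "(\<integral>\<^sup>+x. f x \<partial>lborel) + (\<integral>\<^sup>+x. g x \<partial>lborel)
      = (\<integral>\<^sup>+t. indicator {0<..} t * emeasure lborel {x. ennreal t < f x}
           + indicator {0<..} t * emeasure lborel {x. ennreal t < g x} \<partial>lborel)"
    by (subst (1 2) nn_integral_layer_cake) (auto intro!: nn_integral_add[symmetric])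
  also have "\<dots> \<le> (\<integral>\<^sup>+t. 2 * (indicator {0<..} t * emeasure lborel {x. ennreal t < h x}) \<partial>lborel)"
    by (rule nn_integral_mono) (rule lev)
  also have "\<dots> = 2 * (\<integral>\<^sup>+x. h x \<partial>lborel)"
    by (subst nn_integral_cmult) (auto simp: nn_integral_layer_cake[of h])
  finally show ?thesis .
qed

lemma ennreal_amgm:
  fixes F G H :: ennreal
  assumes "F + G \<le> 2 * H" shows "F * G \<le> H\<^sup>2"
proof (cases "H = \<infinity>")
  case False
  then obtain c where c: "0 \<le> c" "H = ennreal c" by (cases H) auto
  have "2 * H < \<infinity>" using c by (simp add: ennreal_mult_less_top)
  then have "F + G < \<infinity>" using assms by (rule le_less_trans[rotated])
  then obtain a b where ab: "0 \<le> a" "F = ennreal a" "0 \<le> b" "G = ennreal b"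
    by (cases F; cases G) auto
  have "ennreal (a + b) \<le> ennreal (2 * c)"
    using assms ab c by (simp add: ennreal_mult)
  then have "a + b \<le> 2 * c" using c by simp
  then have "(a + b)\<^sup>2 \<le> (2 * c)\<^sup>2" using ab by (intro power_mono) auto
  moreover have "4 * (a * b) \<le> (a + b)\<^sup>2" using zero_le_power2[of "a - b"] by (simp add: power2_eq_square algebra_simps)
  ultimately have "a * b \<le> c\<^sup>2" by (simp add: power2_eq_square)
  then show ?thesis using ab c by (simp add: ennreal_power ennreal_leI flip: ennreal_mult)
qed (simp add: power2_eq_square)

text \<open>
  Rescaling \<open>f\<close>, \<open>g\<close> and \<open>h\<close> by \<open>1 / a\<close>, \<open>1 / b\<close> and \<open>1 / sqrt (a * b)\<close> preserves
  the hypothesis and reduces to suprema equal to 1.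
\<close>

lemma prekopa_leindler_bounded:
  fixes f g h :: "real \<Rightarrow> ennreal"
  assumes [measurable]: "f \<in> borel_measurable borel" "g \<in> borel_measurable borel" "h \<in> borel_measurable borel"
    and bdd: "(SUP x. f x) < \<infinity>" "(SUP x. g x) < \<infinity>"
    and mid: "\<And>x y. f x * g y \<le> (h ((x + y) / 2))\<^sup>2"
  shows "(\<integral>\<^sup>+x. f x \<partial>lborel) * (\<integral>\<^sup>+x. g x \<partial>lborel) \<le> (\<integral>\<^sup>+x. h x \<partial>lborel)\<^sup>2"
proof (cases "(SUP x. f x) = 0 \<or> (SUP x. g x) = 0")
  case True
  then have "(\<forall>x. f x = 0) \<or> (\<forall>x. g x = 0)" by (auto simp: SUP_eq_iff)
  then show ?thesis by auto
next
  case False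
  obtain a where a: "0 < a" "(SUP x. f x) = ennreal a"
    using False bdd by (cases "SUP x. f x") (auto simp: less_le)
  obtain b where b: "0 < b" "(SUP x. g x) = ennreal b"
    using False bdd by (cases "SUP x. g x") (auto simp: less_le)
  let ?a = "ennreal (1 / a)" and ?b = "ennreal (1 / b)" and ?c = "ennreal (1 / sqrt (a * b))"
  have c2: "?c\<^sup>2 = ?a * ?b"
    using a b by (simp add: ennreal_power power_divide flip: ennreal_mult)
  have "(\<integral>\<^sup>+x. ?a * f x \<partial>lborel) + (\<integral>\<^sup>+x. ?b * g x \<partial>lborel) \<le> 2 * (\<integral>\<^sup>+x. ?c * h x \<partial>lborel)"
  proof (rule prekopa_leindler_normalised)
    show "(SUP x. ?a * f x) = 1" "(SUP x. ?b * g x) = 1"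
      using a b by (simp_all add: a(2) b(2) flip: SUP_mult_left_ennreal ennreal_mult)
    fix x y
    have "?a * f x * (?b * g y) = ?c\<^sup>2 * (f x * g y)" by (simp add: c2 ac_simps)
    also have "\<dots> \<le> ?c\<^sup>2 * (h ((x + y) / 2))\<^sup>2" by (rule mult_left_mono[OF mid]) simp
    finally show "?a * f x * (?b * g y) \<le> (?c * h ((x + y) / 2))\<^sup>2" by (simp add: power_mult_distrib)
  qed measurable
  then have "(?a * (\<integral>\<^sup>+x. f x \<partial>lborel)) * (?b * (\<integral>\<^sup>+x. g x \<partial>lborel)) \<le> (?c * (\<integral>\<^sup>+x. h x \<partial>lborel))\<^sup>2"
    by (intro ennreal_amgm) (simp add: nn_integral_cmult)
  then have le: "?c\<^sup>2 * ((\<integral>\<^sup>+x. f x \<partial>lborel) * (\<integral>\<^sup>+x. g x \<partial>lborel)) \<le> ?c\<^sup>2 * (\<integral>\<^sup>+x. h x \<partial>lborel)\<^sup>2"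
    by (simp add: c2 power_mult_distrib ac_simps)
  have inv: "ennreal (a * b) * ?c\<^sup>2 = 1"
    using a b by (simp add: ennreal_power power_divide flip: ennreal_mult)
  show ?thesis
    using mult_left_mono[OF le, of "ennreal (a * b)"] by (simp add: mult.assoc[symmetric] inv)
qed

text \<open>
  Truncating only \<open>f\<close> and \<open>g\<close> keeps the hypothesis with the same \<open>h\<close>, so monotone
  convergence removes the boundedness. Infinite values have to be admitted because the
  sections integrated in the induction over dimension may have infinite integrals.
\<close>

lemma prekopa_leindler_real:
  fixes f g h :: "real \<Rightarrow> ennreal"
  assumes [measurable]: "f \<in> borel_measurable borel" "g \<in> borel_measurable borel" "h \<in> borel_measurable borel"
    and mid: "\<And>x y. f x * g y \<le> (h ((x + y) / 2))\<^sup>2"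
  shows "(\<integral>\<^sup>+x. f x \<partial>lborel) * (\<integral>\<^sup>+x. g x \<partial>lborel) \<le> (\<integral>\<^sup>+x. h x \<partial>lborel)\<^sup>2"
proof -
  have trunc: "(\<integral>\<^sup>+x. u x \<partial>lborel) = (SUP k::nat. \<integral>\<^sup>+x. min (u x) (of_nat k) \<partial>lborel)"
    if [measurable]: "u \<in> borel_measurable borel" for u :: "real \<Rightarrow> ennreal"
  proof -
    have "u x = (SUP k::nat. min (u x) (of_nat k))" for x
    proof -
      have "(SUP k::nat. inf (u x) (of_nat k)) = inf (u x) (SUP k::nat. of_nat k)"
        by (simp add: inf_SUP)
      then show ?thesis by (simp add: inf_min ennreal_SUP_of_nat_eq_top)
    qed
    then have "(\<integral>\<^sup>+x. u x \<partial>lborel) = (\<integral>\<^sup>+x. (SUP k::nat. min (u x) (of_nat k)) \<partial>lborel)" by simp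
    also have "\<dots> = (SUP k::nat. \<integral>\<^sup>+x. min (u x) (of_nat k) \<partial>lborel)"
      by (rule nn_integral_monotone_convergence_SUP)
         (auto simp: incseq_def le_fun_def intro: min.coboundedI2 of_nat_mono)
    finally show ?thesis .
  qed
  have fin: "(SUP x. min (u x) (of_nat k)) < \<infinity>" for u :: "real \<Rightarrow> ennreal" and k :: nat
    by (rule le_less_trans[of _ "of_nat k"]) (auto intro: SUP_least simp: of_nat_less_top)
  have "(\<integral>\<^sup>+x. min (f x) (of_nat i) \<partial>lborel) * (\<integral>\<^sup>+x. min (g x) (of_nat j) \<partial>lborel) \<le> (\<integral>\<^sup>+x. h x \<partial>lborel)\<^sup>2"
    for i j
    by (rule prekopa_leindler_bounded[OF _ _ _ fin fin])
       (auto intro: order_trans[OF mult_mono mid])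
  then show ?thesis
    by (simp add: trunc[of f] trunc[of g] SUP_mult_right_ennreal SUP_mult_left_ennreal SUP_le_iff)
qed


text \<open>
  The hypothesis passes to marginals: for fixed remaining coordinates the one-dimensional
  inequality in coordinate \<open>i\<close> says that the partial integrals satisfy the same hypothesis
  over \<open>I\<close>. Coordinates are indexed by a finite set, since this allows induction
  over the dimension.
\<close>

lemma prekopa_leindler_PiM:
  fixes f g h :: "('i \<Rightarrow> real) \<Rightarrow> ennreal"
  assumes "finite I"
    and "f \<in> borel_measurable (Pi\<^sub>M I (\<lambda>_. lborel))" "g \<in> borel_measurable (Pi\<^sub>M I (\<lambda>_. lborel))"
      "h \<in> borel_measurable (Pi\<^sub>M I (\<lambda>_. lborel))"
    and "\<And>x y. x \<in> extensional I \<Longrightarrow> y \<in> extensional I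
      \<Longrightarrow> f x * g y \<le> (h (\<lambda>i\<in>I. (x i + y i) / 2))\<^sup>2"
  shows "(\<integral>\<^sup>+x. f x \<partial>Pi\<^sub>M I (\<lambda>_. lborel)) * (\<integral>\<^sup>+x. g x \<partial>Pi\<^sub>M I (\<lambda>_. lborel))
    \<le> (\<integral>\<^sup>+x. h x \<partial>Pi\<^sub>M I (\<lambda>_. lborel))\<^sup>2"
  using assms
proof (induction I arbitrary: f g h rule: finite_induct)
  case empty
  interpret product_sigma_finite "\<lambda>_::'i. lborel :: real measure" ..
  have "f (\<lambda>k. undefined) * g (\<lambda>k. undefined) \<le> (h (\<lambda>i\<in>{}. 0))\<^sup>2"
    using empty(4)[of "\<lambda>k. undefined" "\<lambda>k. undefined"] by (simp add: restrict_def)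
  then show ?case by (simp add: nn_integral_empty restrict_def)
next
  case (insert i I)
  interpret product_sigma_finite "\<lambda>_::'i. lborel :: real measure" ..
  note [measurable] = insert.prems(1-3)
  note [simp] = insert.hyps
  show ?case
  proof (subst (1 2 3) product_nn_integral_insert, simp_all del: fun_upd_apply, rule insert.IH)
    fix x y :: "'i \<Rightarrow> real"
    assume x: "x \<in> extensional I" and y: "y \<in> extensional I"
    show "(\<integral>\<^sup>+s. f (x(i := s)) \<partial>lborel) * (\<integral>\<^sup>+s. g (y(i := s)) \<partial>lborel)
      \<le> (\<integral>\<^sup>+s. h ((\<lambda>i\<in>I. (x i + y i) / 2)(i := s)) \<partial>lborel)\<^sup>2"
    proof (rule prekopa_leindler_real)
      have sec: "(\<lambda>s. u (z(i := s))) \<in> borel_measurable borel"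
        if "u \<in> borel_measurable (Pi\<^sub>M (insert i I) (\<lambda>_. lborel :: real measure))" "z \<in> extensional I"
        for u :: "('i \<Rightarrow> real) \<Rightarrow> ennreal" and z
      proof -
        have "z \<in> space (Pi\<^sub>M I (\<lambda>_. lborel :: real measure))" using that by (simp add: space_PiM PiE_def)
        then have "(\<lambda>s. z(i := s)) \<in> measurable lborel (Pi\<^sub>M (insert i I) (\<lambda>_. lborel :: real measure))"
          by (intro measurable_component_update) auto
        from measurable_compose[OF this that(1)] show ?thesis by simp
      qed
      show "(\<lambda>s. f (x(i := s))) \<in> borel_measurable borel" "(\<lambda>s. g (y(i := s))) \<in> borel_measurable borel"
        "(\<lambda>s. h ((\<lambda>i\<in>I. (x i + y i) / 2)(i := s))) \<in> borel_measurable borel"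
        by (rule sec[OF insert.prems(1) x] sec[OF insert.prems(2) y] sec[OF insert.prems(3) restrict_extensional])+
      fix s t :: real
      have mid_eq: "(\<lambda>j\<in>insert i I. ((x(i := s)) j + (y(i := t)) j) / 2) = (\<lambda>i\<in>I. (x i + y i) / 2)(i := (s + t) / 2)"
        by (auto simp: restrict_def fun_eq_iff)
      have "x(i := s) \<in> extensional (insert i I)" "y(i := t) \<in> extensional (insert i I)"
        using x y by (auto simp: extensional_def)
      from insert.prems(4)[OF this]
      show "f (x(i := s)) * g (y(i := t)) \<le> (h ((\<lambda>i\<in>I. (x i + y i) / 2)(i := (s + t) / 2)))\<^sup>2"
        unfolding mid_eq .
    qed
  qed measurable
qed

lemma prekopa_leindler:
  fixes f g h :: "'a::euclidean_space \<Rightarrow> ennreal"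
  assumes [measurable]: "f \<in> borel_measurable borel" "g \<in> borel_measurable borel" "h \<in> borel_measurable borel"
    and mid: "\<And>x y. f x * g y \<le> (h ((1 / 2) *\<^sub>R (x + y)))\<^sup>2"
  shows "(\<integral>\<^sup>+x. f x \<partial>lborel) * (\<integral>\<^sup>+x. g x \<partial>lborel) \<le> (\<integral>\<^sup>+x. h x \<partial>lborel)\<^sup>2"
proof -
  let ?T = "\<lambda>w::'a \<Rightarrow> real. \<Sum>b\<in>Basis. w b *\<^sub>R b"
  have [measurable]: "?T \<in> measurable (Pi\<^sub>M Basis (\<lambda>_. lborel)) borel" by measurable
  have T_mid: "?T (\<lambda>b\<in>Basis. (x b + y b) / 2) = (1 / 2) *\<^sub>R (?T x + ?T y)" for x y
  proof -
    have "?T (\<lambda>b\<in>Basis. (x b + y b) / 2) = (\<Sum>b\<in>Basis. (1 / 2) *\<^sub>R (x b *\<^sub>R b) + (1 / 2) *\<^sub>R (y b *\<^sub>R b))"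
      by (intro sum.cong) (auto simp: add_divide_distrib scaleR_add_left)
    then show ?thesis by (simp add: sum.distrib scaleR_sum_right scaleR_add_right)
  qed
  have tr: "(\<integral>\<^sup>+x. u x \<partial>lborel) = (\<integral>\<^sup>+w. u (?T w) \<partial>Pi\<^sub>M Basis (\<lambda>_. lborel))"
    if [measurable]: "u \<in> borel_measurable borel" for u :: "'a \<Rightarrow> ennreal"
    by (subst lborel_eq) (rule nn_integral_distr; measurable)
  show ?thesis
    unfolding tr[OF assms(1)] tr[OF assms(2)] tr[OF assms(3)]
  proof (rule prekopa_leindler_PiM)
    show "f (?T x) * g (?T y) \<le> (h (?T (\<lambda>b\<in>Basis. (x b + y b) / 2)))\<^sup>2" for x y
      unfolding T_mid by (rule mid)
  qed (simp, measurable)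
qed

section \<open>Second-order calculus\<close>

lemma has_derivative_gradient:
  assumes "f differentiable_on UNIV"
  shows "(f has_derivative (\<lambda>h. gradient f x \<bullet> h)) (at x)"
proof -
  have der: "(f has_derivative frechet_derivative f (at x)) (at x)"
    using assms by (auto simp: differentiable_on_def frechet_derivative_works)
  have "frechet_derivative f (at x) h = gradient f x \<bullet> h" for h
  proof -
    interpret bounded_linear "frechet_derivative f (at x)" using der by (rule has_derivative_bounded_linear)
    have "frechet_derivative f (at x) (\<Sum>i\<in>UNIV. (h $ i) *\<^sub>R axis i 1) = (\<Sum>i\<in>UNIV. h $ i * gradient f x $ i)"
      by (simp add: sum scaleR gradient_def)
    moreover have "(\<Sum>i\<in>UNIV. (h $ i) *\<^sub>R axis i 1) = h"
      using basis_expansion[of h] by (simp add: scalar_mult_eq_scaleR)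
    ultimately show ?thesis by (simp add: inner_vec_def mult.commute)
  qed
  then have "frechet_derivative f (at x) = (\<lambda>h. gradient f x \<bullet> h)" by (rule ext)
  then show ?thesis using der by simp
qed

lemma has_derivative_hessian:
  assumes "C2 V"
  shows "(gradient V has_derivative (\<lambda>h. hessian V x *v h)) (at x)"
  using assms jacobian_works[of "gradient V" "at x"]
  by (auto simp: C2_def differentiable_on_def hessian_def)

lemma DERIV_along_line:
  assumes "f differentiable_on UNIV"
  shows "((\<lambda>t. f (z + t *\<^sub>R a)) has_real_derivative gradient f (z + t *\<^sub>R a) \<bullet> a) (at t)"
proof -
  have "((\<lambda>t. f (z + t *\<^sub>R a)) has_derivative (\<lambda>h. gradient f (z + t *\<^sub>R a) \<bullet> (h *\<^sub>R a))) (at t)"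
    by (rule has_derivative_compose[OF _ has_derivative_gradient[OF assms]])
       (auto intro!: derivative_eq_intros)
  then show ?thesis by (simp add: has_field_derivative_def mult.commute[of _ "_ \<bullet> _"])
qed

lemma DERIV_gradient_along_line:
  assumes "C2 V"
  shows "((\<lambda>t. gradient V (z + t *\<^sub>R a) \<bullet> b) has_real_derivative (hessian V (z + t *\<^sub>R a) *v a) \<bullet> b) (at t)"
proof -
  have "((\<lambda>t. gradient V (z + t *\<^sub>R a)) has_derivative (\<lambda>h. hessian V (z + t *\<^sub>R a) *v (h *\<^sub>R a))) (at t)"
    by (rule has_derivative_compose[OF _ has_derivative_hessian[OF assms]])
       (auto intro!: derivative_eq_intros)
  from has_derivative_inner_left[OF this, of b] show ?thesis
    by (simp add: has_field_derivative_def matrix_vector_mult_scaleR mult.commute[of _ "_ \<bullet> _"])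
qed

lemma continuous_on_matrix_vector_mult:
  assumes "continuous_on S A" "continuous_on S v"
  shows "continuous_on S (\<lambda>x. (A x :: real^'n^'m) *v v x)"
  unfolding matrix_vector_mult_def
  by (intro continuous_on_vec_lambda continuous_intros assms)

lemma C1_mvt:
  assumes "C1 f"
  obtains w where "w \<in> closed_segment x y" "f y - f x = gradient f w \<bullet> (y - x)"
proof -
  have d: "f differentiable_on UNIV" using assms by (simp add: C1_def)
  have "\<exists>t. 0 < t \<and> t < 1 \<and> f (x + 1 *\<^sub>R (y - x)) - f (x + 0 *\<^sub>R (y - x)) = (1 - 0) * (gradient f (x + t *\<^sub>R (y - x)) \<bullet> (y - x))"
    by (rule MVT2) (auto intro: DERIV_along_line[OF d])
  then obtain t where t: "0 < t" "t < 1" "f y - f x = gradient f (x + t *\<^sub>R (y - x)) \<bullet> (y - x)" by auto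
  moreover have "x + t *\<^sub>R (y - x) \<in> closed_segment x y"
    using t by (auto simp: closed_segment_def algebra_simps intro!: exI[of _ t])
  ultimately show ?thesis using that by blast
qed

lemma C2_taylor:
  assumes "C2 V"
  obtains w where "w \<in> closed_segment z x"
    "V x = V z + gradient V z \<bullet> (x - z) + (1 / 2) * ((x - z) \<bullet> (hessian V w *v (x - z)))"
proof -
  let ?a = "x - z"
  have d: "V differentiable_on UNIV" using assms by (simp add: C1_def C2_def)
  define D where "D m = (if m = 0 then (\<lambda>t. V (z + t *\<^sub>R ?a)) else if m = 1 then (\<lambda>t. gradient V (z + t *\<^sub>R ?a) \<bullet> ?a)
      else (\<lambda>t. (hessian V (z + t *\<^sub>R ?a) *v ?a) \<bullet> ?a))" for m :: nat
  have "\<exists>t>0. t < 1 \<and> D 0 1 = (\<Sum>m<2. D m 0 / fact m * 1 ^ m) + D 2 t / fact 2 * 1 ^ 2"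
    using DERIV_along_line[OF d, of z ?a] DERIV_gradient_along_line[OF assms, of z ?a ?a]
    by (intro Maclaurin) (auto simp: D_def less_Suc_eq numeral_2_eq_2)
  then obtain t where t: "0 < t" "t < 1"
    "V x = V z + gradient V z \<bullet> ?a + (1/2) * ((hessian V (z + t *\<^sub>R ?a) *v ?a) \<bullet> ?a)"
    by (auto simp: D_def eval_nat_numeral)
  moreover have "z + t *\<^sub>R ?a \<in> closed_segment z x"
    using t by (auto simp: closed_segment_def algebra_simps intro!: exI[of _ t])
  ultimately show ?thesis using that by (simp add: inner_commute)
qed

text \<open>
  Applying the mean value theorem first along \<open>a\<close> and then along \<open>b\<close> expresses the
  symmetric second difference by the Hessian at a point close to \<open>z\<close>. The difference is
  symmetric in \<open>a\<close> and \<open>b\<close>, so letting \<open>s\<close> tend to 0 yields the symmetry of the Hessian.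
\<close>

lemma mixed_second_difference:
  assumes V: "C2 V" and s: "0 < s"
  shows "\<exists>w. dist w z \<le> s * (norm a + norm b) \<and>
    V (z + s *\<^sub>R a + s *\<^sub>R b) - V (z + s *\<^sub>R a) - V (z + s *\<^sub>R b) + V z = s\<^sup>2 * ((hessian V w *v b) \<bullet> a)"
proof -
  have d: "V differentiable_on UNIV" using V by (simp add: C1_def C2_def)
  let ?u = "\<lambda>t. V ((z + s *\<^sub>R b) + t *\<^sub>R a) - V (z + t *\<^sub>R a)"
  have "\<exists>t. 0 < t \<and> t < s \<and> ?u s - ?u 0 = (s - 0) * (gradient V ((z + s *\<^sub>R b) + t *\<^sub>R a) \<bullet> a - gradient V (z + t *\<^sub>R a) \<bullet> a)"
    by (rule MVT2[OF s]) (intro DERIV_diff DERIV_along_line[OF d])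
  then obtain t where t: "0 < t" "t < s"
    "?u s - ?u 0 = s * (gradient V ((z + s *\<^sub>R b) + t *\<^sub>R a) \<bullet> a - gradient V (z + t *\<^sub>R a) \<bullet> a)" by auto
  let ?v = "\<lambda>r. gradient V ((z + t *\<^sub>R a) + r *\<^sub>R b) \<bullet> a"
  have "\<exists>r. 0 < r \<and> r < s \<and> ?v s - ?v 0 = (s - 0) * ((hessian V ((z + t *\<^sub>R a) + r *\<^sub>R b) *v b) \<bullet> a)"
    by (rule MVT2[OF s]) (rule DERIV_gradient_along_line[OF V])
  then obtain r where r: "0 < r" "r < s" "?v s - ?v 0 = s * ((hessian V ((z + t *\<^sub>R a) + r *\<^sub>R b) *v b) \<bullet> a)" by auto
  let ?w = "(z + t *\<^sub>R a) + r *\<^sub>R b"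
  have "dist ?w z \<le> norm (t *\<^sub>R a) + norm (r *\<^sub>R b)"
    by (simp add: dist_norm add.assoc) (metis norm_scaleR norm_triangle_ineq)
  also have "\<dots> \<le> s * norm a + s * norm b"
    using t r by (intro add_mono) (auto intro: mult_right_mono)
  finally have "dist ?w z \<le> s * (norm a + norm b)" by (simp add: algebra_simps)
  moreover have "V (z + s *\<^sub>R a + s *\<^sub>R b) - V (z + s *\<^sub>R a) - V (z + s *\<^sub>R b) + V z = s\<^sup>2 * ((hessian V ?w *v b) \<bullet> a)"
    using t(3) r(3) by (simp add: power2_eq_square add_ac)
  ultimately show ?thesis by blast
qed

lemma hessian_symmetric:
  fixes V :: "real ^ 'n \<Rightarrow> real"
  assumes V: "C2 V"
  shows "(hessian V z *v b) \<bullet> a = (hessian V z *v a) \<bullet> b"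
proof -
  have cont: "continuous_on UNIV (hessian V)" using V by (simp add: C2_def)
  let ?s = "\<lambda>k. inverse (real (Suc k))"
  let ?P = "\<lambda>a b k w. dist w z \<le> ?s k * (norm a + norm b) \<and>
    V (z + ?s k *\<^sub>R a + ?s k *\<^sub>R b) - V (z + ?s k *\<^sub>R a) - V (z + ?s k *\<^sub>R b) + V z = (?s k)\<^sup>2 * ((hessian V w *v b) \<bullet> a)"
  have lim: "(\<lambda>k. (hessian V (w k) *v d) \<bullet> c) \<longlonglongrightarrow> (hessian V z *v d) \<bullet> c"
    if w: "\<And>k. dist (w k) z \<le> ?s k * C" for w c d C
  proof -
    have "(\<lambda>k. ?s k * C) \<longlonglongrightarrow> 0 * C" by (intro tendsto_intros LIMSEQ_inverse_real_of_nat)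
    then have "(\<lambda>k. ?s k * C) \<longlonglongrightarrow> 0" by (simp only: mult_zero_left)
    moreover have "\<forall>\<^sub>F k in sequentially. norm (dist (w k) z) \<le> ?s k * C"
      using w by (simp del: of_nat_Suc)
    ultimately have "(\<lambda>k. dist (w k) z) \<longlonglongrightarrow> 0"
      by (rule Lim_null_comparison[rotated])
    then have wz: "w \<longlonglongrightarrow> z" using tendsto_dist_iff by blast
    have "continuous_on UNIV (\<lambda>x. (hessian V x *v d) \<bullet> c)"
      by (intro continuous_intros continuous_on_matrix_vector_mult cont)
    from continuous_on_tendsto_compose[OF this wz] show ?thesis by auto
  qed
  have "\<forall>k. \<exists>w. ?P a b k w" by (intro allI mixed_second_difference[OF V]) simp
  then obtain w where w: "\<And>k. ?P a b k (w k)" by metis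
  have "\<forall>k. \<exists>w. ?P b a k w" by (intro allI mixed_second_difference[OF V]) simp
  then obtain w' where w': "\<And>k. ?P b a k (w' k)" by metis
  have "(hessian V (w k) *v b) \<bullet> a = (hessian V (w' k) *v a) \<bullet> b" for k
  proof -
    have swap: "z + ?s k *\<^sub>R a + ?s k *\<^sub>R b = z + ?s k *\<^sub>R b + ?s k *\<^sub>R a"
      by (simp only: add.assoc add.commute[of "?s k *\<^sub>R a"])
    have "(?s k)\<^sup>2 * ((hessian V (w k) *v b) \<bullet> a) = (?s k)\<^sup>2 * ((hessian V (w' k) *v a) \<bullet> b)"
      using conjunct2[OF w[of k]] conjunct2[OF w'[of k]] unfolding swap by argo
    then show ?thesis by (simp del: of_nat_Suc)
  qed
  then have "(\<lambda>k. (hessian V (w k) *v b) \<bullet> a) \<longlonglongrightarrow> (hessian V z *v a) \<bullet> b"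
    using lim[of w' "norm b + norm a" a b] w' by simp
  moreover have "(\<lambda>k. (hessian V (w k) *v b) \<bullet> a) \<longlonglongrightarrow> (hessian V z *v b) \<bullet> a"
    using lim[of w "norm a + norm b" b a] w by simp
  ultimately show ?thesis using LIMSEQ_unique by blast
qed

section \<open>The dual of a positive definite quadratic form\<close>

lemma positive_definite_nonneg:
  assumes "positive_definite A"
  shows "0 \<le> x \<bullet> (A *v x)"
  using assms by (cases "x = 0") (auto simp: positive_definite_def less_imp_le)

lemma positive_definite_invertible:
  fixes A :: "real ^ 'n ^ 'n"
  assumes "positive_definite A"
  shows "invertible A"
proof -
  have "inj ((*v) A)"
  proof (rule injI)
    fix x y assume "A *v x = A *v y"
    then have "(x - y) \<bullet> (A *v (x - y)) = 0" by (simp add: matrix_vector_mult_diff_distrib)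
    then show "x = y" using assms by (auto simp: positive_definite_def dest!: spec[of _ "x - y"])
  qed
  then show ?thesis
    using matrix_left_invertible_injective[of A] invertible_left_inverse[of A] by auto
qed

lemma matrix_inv_mult_vector:
  fixes A :: "real ^ 'n ^ 'n"
  assumes "invertible A"
  shows "A *v (matrix_inv A *v g) = g"
proof -
  have "A ** matrix_inv A = mat 1 \<and> matrix_inv A ** A = mat 1"
    unfolding matrix_inv_def using assms unfolding invertible_def by (rule someI_ex)
  then show ?thesis by (simp add: matrix_vector_mul_assoc)
qed

lemma dual_form_nonneg:
  assumes "positive_definite A"
  shows "0 \<le> g \<bullet> (matrix_inv A *v g)"
proof -
  let ?y = "matrix_inv A *v g"
  have "g \<bullet> ?y = ?y \<bullet> (A *v ?y)"
    by (simp add: matrix_inv_mult_vector[OF positive_definite_invertible[OF assms]] inner_commute)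
  also have "\<dots> \<ge> 0" by (rule positive_definite_nonneg[OF assms])
  finally show ?thesis .
qed

text \<open>
  The Cauchy-Schwarz inequality for the inner product with Gram matrix \<open>A\<close>, applied to \<open>d\<close> and
  \<open>y = matrix_inv A *v g\<close>, for which \<open>g \<bullet> d\<close> is the product of \<open>y\<close> and \<open>d\<close> and \<open>g \<bullet> y\<close> the square of \<open>y\<close>.
\<close>

lemma dual_form_Cauchy_Schwarz:
  assumes pd: "positive_definite A" and sym: "\<And>a b. (A *v b) \<bullet> a = (A *v a) \<bullet> b"
  shows "(g \<bullet> d)\<^sup>2 \<le> (g \<bullet> (matrix_inv A *v g)) * (d \<bullet> (A *v d))"
proof (cases "d = 0")
  case False
  let ?y = "matrix_inv A *v g" and ?D = "d \<bullet> (A *v d)"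
  have Ay: "A *v ?y = g" by (rule matrix_inv_mult_vector[OF positive_definite_invertible[OF pd]])
  have D: "0 < ?D" using pd False by (auto simp: positive_definite_def)
  define t where "t = - (g \<bullet> d) / ?D"
  have "0 \<le> (?y + t *\<^sub>R d) \<bullet> (A *v (?y + t *\<^sub>R d))"
    by (rule positive_definite_nonneg[OF pd])
  also have "\<dots> = g \<bullet> ?y + 2 * t * (g \<bullet> d) + t\<^sup>2 * ?D"
    using sym[of ?y d] Ay
    by (simp add: matrix_vector_right_distrib matrix_vector_mult_scaleR inner_add power2_eq_square
        algebra_simps inner_commute)
  also have "\<dots> = g \<bullet> ?y - (g \<bullet> d)\<^sup>2 / ?D"
    using D by (simp add: t_def power2_eq_square field_simps)
  finally show ?thesis using D by (simp add: field_simps)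
qed simp

text \<open>
  Cramer's rule writes the solution of a linear system as a quotient of determinants,
  which are polynomials in the entries.
\<close>

lemma continuous_on_matrix_inv_mult_vector:
  fixes A :: "'a::topological_space \<Rightarrow> real ^ 'n ^ 'n"
  assumes A: "continuous_on S A" and g: "continuous_on S g" and inv: "\<And>x. x \<in> S \<Longrightarrow> invertible (A x)"
  shows "continuous_on S (\<lambda>x. matrix_inv (A x) *v g x)"
proof -
  have det: "continuous_on S (\<lambda>x. det (B x))" if "\<And>i j. continuous_on S (\<lambda>x. B x $ i $ j)" for B :: "'a \<Rightarrow> real ^ 'n ^ 'n"
    unfolding det_def by (intro continuous_intros that)
  have nz: "det (A x) \<noteq> 0" if "x \<in> S" for x using inv[OF that] invertible_det_nz by blast
  have eq: "matrix_inv (A x) *v g x = (\<chi> k. det (\<chi> i j. if j = k then g x $ i else A x $ i $ j) / det (A x))" if "x \<in> S" for x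
    using cramer[OF nz[OF that]] matrix_inv_mult_vector[OF inv[OF that]] by blast
  have "continuous_on S (\<lambda>x. \<chi> k. det (\<chi> i j. if j = k then g x $ i else A x $ i $ j) / det (A x))"
  proof (intro continuous_on_vec_lambda continuous_on_divide det)
    fix k i j
    show "continuous_on S (\<lambda>x. (\<chi> i j. if j = k then g x $ i else A x $ i $ j) $ i $ j)"
      by (cases "j = k") (auto intro!: continuous_intros A g)
  qed (auto intro!: continuous_intros A nz)
  then show ?thesis by (rule continuous_on_eq) (simp add: eq)
qed

section \<open>Uniform bounds for the Hessian and the Bregman divergence\<close>

text \<open>
  The quadratic form is homogeneous, so it suffices that its minimum over the compact set
  \<open>K\<close> times the unit sphere is positive.
\<close>

lemma hessian_form_lower_bound:
  fixes V :: "real ^ 'n \<Rightarrow> real"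
  assumes V: "C2 V" and pd: "\<And>x. positive_definite (hessian V x)" and K: "compact K"
  obtains l where "0 < l" "\<And>z d. z \<in> K \<Longrightarrow> l * (norm d)\<^sup>2 \<le> d \<bullet> (hessian V z *v d)"
proof (cases "K = {}")
  case True
  then show ?thesis using that[of 1] by simp
next
  case False
  let ?F = "\<lambda>p. snd p \<bullet> (hessian V (fst p) *v snd p)"
  have cV: "continuous_on UNIV (hessian V)" using V by (simp add: C2_def)
  obtain e :: "real ^ 'n" where e: "norm e = 1" using vector_choose_size[of 1] by auto
  have "continuous_on (K \<times> sphere 0 1) ?F"
    by (intro continuous_intros continuous_on_matrix_vector_mult continuous_on_compose2[OF cV]) auto
  moreover have "compact (K \<times> sphere (0 :: real ^ 'n) 1)" using K by (intro compact_Times) auto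
  moreover have "K \<times> sphere (0 :: real ^ 'n) 1 \<noteq> {}" using False e by auto
  ultimately obtain p where p: "p \<in> K \<times> sphere 0 1" "\<And>q. q \<in> K \<times> sphere 0 1 \<Longrightarrow> ?F p \<le> ?F q"
    using continuous_attains_inf[of "K \<times> sphere 0 1" ?F] by blast
  show ?thesis
  proof (rule that[of "?F p"])
    have "snd p \<noteq> 0" using p(1) by auto
    then show "0 < ?F p" using pd[of "fst p"] by (simp add: positive_definite_def)
    fix z d assume z: "z \<in> K"
    show "?F p * (norm d)\<^sup>2 \<le> d \<bullet> (hessian V z *v d)"
    proof (cases "d = 0")
      case False
      have "?F p \<le> ?F (z, (1 / norm d) *\<^sub>R d)" using z False by (intro p(2)) auto
      also have "\<dots> = (d \<bullet> (hessian V z *v d)) / (norm d)\<^sup>2"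
        by (simp add: matrix_vector_mult_scaleR power2_eq_square)
      finally show ?thesis using False by (simp add: pos_le_divide_eq)
    qed simp
  qed
qed

text \<open>
  The Hessian varies little, measured relative to itself: an additive error for unit
  vectors, from uniform continuity on a compact set, turns into a multiplicative one because
  the form is bounded below there.
\<close>

lemma hessian_form_uniformly_continuous:
  fixes V :: "real ^ 'n \<Rightarrow> real"
  assumes V: "C2 V" and pd: "\<And>x. positive_definite (hessian V x)" and K: "compact K" and \<theta>: "0 < \<theta>"
  obtains r where "0 < r" "\<And>z w d. z \<in> K \<Longrightarrow> w \<in> K \<Longrightarrow> dist w z < r
    \<Longrightarrow> (1 - \<theta>) * (d \<bullet> (hessian V z *v d)) \<le> d \<bullet> (hessian V w *v d)"
proof -
  obtain l where l: "0 < l" "\<And>z d. z \<in> K \<Longrightarrow> l * (norm d)\<^sup>2 \<le> d \<bullet> (hessian V z *v d)"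
    using hessian_form_lower_bound[OF V pd K] by blast
  let ?F = "\<lambda>p. snd p \<bullet> (hessian V (fst p) *v snd p)"
  have cV: "continuous_on UNIV (hessian V)" using V by (simp add: C2_def)
  have "continuous_on (K \<times> sphere 0 1) ?F"
    by (intro continuous_intros continuous_on_matrix_vector_mult continuous_on_compose2[OF cV]) auto
  moreover have "compact (K \<times> sphere (0 :: real ^ 'n) 1)" using K by (intro compact_Times) auto
  ultimately have uc: "uniformly_continuous_on (K \<times> sphere 0 1) ?F"
    by (rule compact_uniformly_continuous)
  obtain r where r: "0 < r"
    "\<forall>p\<in>K \<times> sphere 0 1. \<forall>q\<in>K \<times> sphere 0 1. dist q p < r \<longrightarrow> dist (?F q) (?F p) < \<theta> * l"
    using uc[unfolded uniformly_continuous_on_def, rule_format, OF mult_pos_pos[OF \<theta> l(1)]] by (elim exE conjE)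
  show ?thesis
  proof (rule that[OF r(1)])
    fix z w d assume z: "z \<in> K" and w: "w \<in> K" and zw: "dist w z < r"
    show "(1 - \<theta>) * (d \<bullet> (hessian V z *v d)) \<le> d \<bullet> (hessian V w *v d)"
    proof (cases "d = 0")
      case False
      let ?e = "(1 / norm d) *\<^sub>R d"
      have F: "?F (x, ?e) = (d \<bullet> (hessian V x *v d)) / (norm d)\<^sup>2" for x
        by (simp add: matrix_vector_mult_scaleR power2_eq_square)
      have "dist (?F (w, ?e)) (?F (z, ?e)) < \<theta> * l"
        using z w zw False by (intro r(2)[rule_format]) (auto simp: dist_Pair_Pair)
      then have "?F (z, ?e) - ?F (w, ?e) \<le> \<theta> * l" by (simp add: dist_real_def)
      then have "(d \<bullet> (hessian V z *v d)) - (d \<bullet> (hessian V w *v d)) \<le> \<theta> * (l * (norm d)\<^sup>2)"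
        unfolding F using False by (simp add: diff_divide_distrib[symmetric] pos_divide_le_eq)
      also have "\<dots> \<le> \<theta> * (d \<bullet> (hessian V z *v d))"
        using l(2)[OF z] \<theta> by (intro mult_left_mono) auto
      finally show ?thesis by (simp add: algebra_simps)
    qed simp
  qed
qed

text \<open>
  The Bregman divergence of \<open>V\<close>: the amount by which \<open>V x\<close> exceeds the tangent at \<open>z\<close>.
\<close>

definition bregman :: "(real ^ 'n \<Rightarrow> real) \<Rightarrow> real ^ 'n \<Rightarrow> real ^ 'n \<Rightarrow> real" where
  "bregman V x z = V x - V z - gradient V z \<bullet> (x - z)"

lemma bregman_taylor:
  assumes "C2 V"
  obtains w where "w \<in> closed_segment z x" "bregman V x z = (1 / 2) * ((x - z) \<bullet> (hessian V w *v (x - z)))"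
proof -
  obtain w where "w \<in> closed_segment z x"
    "V x = V z + gradient V z \<bullet> (x - z) + (1 / 2) * ((x - z) \<bullet> (hessian V w *v (x - z)))"
    by (rule C2_taylor[OF assms])
  then show ?thesis using that[of w] by (simp add: bregman_def)
qed

lemma bregman_nonneg:
  assumes V: "C2 V" and pd: "\<And>x. positive_definite (hessian V x)"
  shows "0 \<le> bregman V x z"
proof -
  obtain w where "bregman V x z = (1 / 2) * ((x - z) \<bullet> (hessian V w *v (x - z)))"
    by (rule bregman_taylor[OF V])
  then show ?thesis using positive_definite_nonneg[OF pd, of "x - z" w] by linarith
qed

text \<open>
  Let \<open>w\<close> be the point at distance \<open>\<rho>\<close> from \<open>x\<close> on the segment towards \<open>z\<close>. The divergence
  \<open>bregman V x\<close> grows along rays from \<open>x\<close>, because the gradient of \<open>V\<close> is monotone; hence the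
  second-order bound at \<open>w\<close> also holds at \<open>z\<close>. Only the Hessian near the first argument enters,
  which is what makes the estimate usable for \<open>x\<close> in a compact set and \<open>z\<close> arbitrary.
\<close>

lemma bregman_far:
  assumes V: "C2 V" and pd: "\<And>x. positive_definite (hessian V x)"
    and \<rho>: "0 < \<rho>" "\<rho> \<le> dist x z"
    and l: "\<And>w d. w \<in> cball x \<rho> \<Longrightarrow> l * (norm d)\<^sup>2 \<le> d \<bullet> (hessian V w *v d)"
  shows "l * \<rho>\<^sup>2 / 2 \<le> bregman V x z"
proof -
  define e where "e = z - x"
  have dist_e: "dist x z = norm e" by (simp add: e_def dist_norm norm_minus_commute)
  define s where "s = \<rho> / norm e"
  have e: "0 < norm e" using \<rho> dist_e by linarith
  have s: "0 < s" "s \<le> 1" using \<rho> e unfolding dist_e s_def by (simp_all add: pos_divide_le_eq)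
  define w where "w = x + s *\<^sub>R e"
  have wx: "x - w = - (s *\<^sub>R e)" and zw: "z - w = (1 - s) *\<^sub>R e" and zx: "x - z = - e"
    by (simp_all add: w_def e_def algebra_simps)
  have xw: "norm (x - w) = \<rho>" using e \<rho>(1) by (simp add: wx s_def)
  obtain u where u: "u \<in> closed_segment w x" "bregman V x w = (1 / 2) * ((x - w) \<bullet> (hessian V u *v (x - w)))"
    by (rule bregman_taylor[OF V])
  have "u \<in> cball x \<rho>"
    using u(1) segment_bound(2)[of u w x] xw by (auto simp: dist_norm norm_minus_commute)
  then have near: "l * \<rho>\<^sup>2 / 2 \<le> bregman V x w"
    using l[of u "x - w"] u(2) xw by simp
  have wz: "w - z = - ((1 - s) *\<^sub>R e)" using zw by (metis minus_diff_eq)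
  let ?G = "gradient V z \<bullet> e - gradient V w \<bullet> e"
  have "0 \<le> bregman V z w + bregman V w z"
    by (intro add_nonneg_nonneg bregman_nonneg V pd)
  also have "\<dots> = (1 - s) * ?G"
    unfolding bregman_def zw wz by (simp add: algebra_simps)
  finally have mono: "0 \<le> (1 - s) * ?G" .
  have "bregman V x z - bregman V x w = bregman V w z + s * ?G"
    unfolding bregman_def wx wz zx by (simp add: algebra_simps)
  also have "\<dots> \<ge> 0"
  proof (cases "s = 1")
    case True
    then have "w = z" by (simp add: w_def e_def)
    then show ?thesis by (simp add: bregman_def)
  next
    case False
    then have "0 \<le> ?G" using mono s by (simp add: zero_le_mult_iff)
    then show ?thesis using bregman_nonneg[OF V pd, of w z] s by simp
  qed
  finally show ?thesis using near by simp
qed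

lemma compactly_supported_zero:
  assumes "x \<notin> closure {x. f x \<noteq> 0}"
  shows "f x = 0"
proof (rule ccontr)
  assume "f x \<noteq> 0"
  then have "x \<in> closure {x. f x \<noteq> 0}" by (intro subsetD[OF closure_subset]) simp
  with assms show False by contradiction
qed

lemma gradient_zero_off_support:
  assumes "x \<notin> closure {x. f x \<noteq> 0}"
  shows "gradient f x = 0"
proof -
  have "(f has_derivative (\<lambda>_. 0)) (at x)"
  proof (rule has_derivative_transform_within_open)
    show "((\<lambda>_. 0) has_derivative (\<lambda>_. 0)) (at x)" by simp
    show "open (- closure {x. f x \<noteq> 0})" by (intro open_Compl closed_closure)
    show "x \<in> - closure {x. f x \<noteq> 0}" using assms by simp
    show "0 = f y" if "y \<in> - closure {x. f x \<noteq> 0}" for y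
      using that compactly_supported_zero[of y f] by simp
  qed
  from frechet_derivative_at[OF this, symmetric] show ?thesis
    by (simp add: gradient_def vec_eq_iff)
qed

section \<open>Midpoint convexity under small perturbations\<close>

text \<open>
  The local computation behind the midpoint inequality, with real numbers only. In the
  application, \<open>x - y = d\<close> has length \<open>N\<close>, the Hessian form of \<open>d\<close> is \<open>A\<close> at the midpoint and
  \<open>P\<close> and \<open>R\<close> at the two intermediate points of Taylor's formula, and \<open>g\<close>, \<open>G\<close> are directional
  derivatives of \<open>f\<close> at the midpoint and nearby. Ignoring the errors, the claim is
  \<open>A / 4 + \<delta> * g \<ge> - \<delta>\<^sup>2 * q\<close>, which is the inequality of the means and \<open>g\<^sup>2 \<le> q * A\<close>.
  A fraction \<open>\<tau>\<close> of the quadratic term is spent on the error in \<open>g\<close>, and another on the errors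
  in the quadratic term.
\<close>

lemma near_midpoint_estimate:
  fixes \<tau> \<epsilon> \<delta> \<sigma> l \<eta> q A N P R g G :: real
  assumes pos: "0 < \<tau>" "\<tau> \<le> 1 / 4" "0 < \<epsilon>" "0 < \<delta>" "0 < l" "0 \<le> q" "0 \<le> A" "0 \<le> N"
    and \<tau>: "2 * \<tau> * (q + \<epsilon>) \<le> \<epsilon>" and \<eta>: "\<eta>\<^sup>2 = \<epsilon> * \<tau> * l" and \<sigma>: "\<bar>\<sigma>\<bar> \<le> \<tau> / 2"
    and lN: "l * N\<^sup>2 \<le> A" and P: "(1 - \<tau> / 2) * A \<le> P" and R: "(1 - \<tau> / 2) * A \<le> R"
    and g: "g\<^sup>2 \<le> q * A" and G: "g - \<eta> * N \<le> G"
  shows "- \<delta>\<^sup>2 * (q / 2 + \<epsilon>)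
    \<le> (1 / 2) * ((1 + \<sigma>) * (1 - \<sigma>)\<^sup>2 / 8 * P + (1 - \<sigma>) * (1 + \<sigma>)\<^sup>2 / 8 * R + \<delta> * G)"
proof -
  let ?k = "1 - 2 * \<tau>"
  have k: "0 < ?k" using pos by simp
  have s: "\<bar>\<sigma>\<bar> \<le> 1" using \<sigma> pos by simp
  have "\<sigma>\<^sup>2 \<le> \<bar>\<sigma>\<bar>" using s mult_left_le_one_le[of "\<bar>\<sigma>\<bar>" "\<bar>\<sigma>\<bar>"] by (simp add: power2_eq_square)
  then have \<sigma>2: "\<sigma>\<^sup>2 \<le> \<tau> / 2" using \<sigma> by simp
  have "(1 - \<tau>) \<le> (1 - \<sigma>\<^sup>2) * (1 - \<tau> / 2)"
  proof -
    have "(1 - \<tau> / 2) * (1 - \<tau> / 2) \<le> (1 - \<sigma>\<^sup>2) * (1 - \<tau> / 2)" using \<sigma>2 pos by (intro mult_right_mono) auto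
    moreover have "(1 - \<tau> / 2) * (1 - \<tau> / 2) = 1 - \<tau> + \<tau>\<^sup>2 / 4" by (simp add: power2_eq_square algebra_simps)
    ultimately show ?thesis using zero_le_power2[of \<tau>] by linarith
  qed
  then have "(1 - \<tau>) * A / 4 \<le> (1 - \<sigma>\<^sup>2) * (1 - \<tau> / 2) * A / 4"
    using pos by (intro divide_right_mono mult_right_mono) auto
  also have "\<dots> = (1 + \<sigma>) * (1 - \<sigma>)\<^sup>2 / 8 * ((1 - \<tau> / 2) * A) + (1 - \<sigma>) * (1 + \<sigma>)\<^sup>2 / 8 * ((1 - \<tau> / 2) * A)"
    by (simp add: power2_eq_square field_simps)
  also have "\<dots> \<le> (1 + \<sigma>) * (1 - \<sigma>)\<^sup>2 / 8 * P + (1 - \<sigma>) * (1 + \<sigma>)\<^sup>2 / 8 * R"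
    using s by (intro add_mono mult_left_mono P R) auto
  finally have quad: "(1 - \<tau>) * A / 4 \<le> (1 + \<sigma>) * (1 - \<sigma>)\<^sup>2 / 8 * P + (1 - \<sigma>) * (1 + \<sigma>)\<^sup>2 / 8 * R" .
  have amgm: "4 * a * b \<le> (a + b)\<^sup>2" for a b :: real
    using zero_le_power2[of "a - b"] by (simp add: power2_sum power2_diff)
  let ?X = "?k * A / 4" and ?Y = "\<delta>\<^sup>2 * q / ?k"
  have XY: "0 \<le> ?X" "0 \<le> ?Y" using k pos by auto
  have "(\<delta> * g)\<^sup>2 \<le> \<delta>\<^sup>2 * (q * A)" using g by (simp add: power_mult_distrib mult_left_mono)
  also have "\<dots> = 4 * ?X * ?Y" using k by (simp add: field_simps)
  also have "\<dots> \<le> (?X + ?Y)\<^sup>2" by (rule amgm)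
  finally have "\<bar>\<delta> * g\<bar> \<le> ?X + ?Y" using XY abs_le_square_iff[of "\<delta> * g" "?X + ?Y"] by simp
  then have lin1: "- (?X + ?Y) \<le> \<delta> * g" by linarith
  have "0 \<le> \<tau> * l / 4 * (N - 2 * \<delta> * \<eta> / (\<tau> * l))\<^sup>2" using pos by simp
  also have "\<dots> = \<tau> * (l * N\<^sup>2) / 4 - \<delta> * \<eta> * N + \<delta>\<^sup>2 * \<eta>\<^sup>2 / (\<tau> * l)"
    using pos by (simp add: power2_eq_square field_simps)
  also have "\<delta>\<^sup>2 * \<eta>\<^sup>2 / (\<tau> * l) = \<delta>\<^sup>2 * \<epsilon>" using pos \<eta> by simp
  finally have lin2: "\<delta> * \<eta> * N \<le> \<tau> * A / 4 + \<delta>\<^sup>2 * \<epsilon>"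
    using mult_left_mono[OF lN less_imp_le[OF pos(1)]] by argo
  have "q \<le> (q + \<epsilon>) * ?k" using \<tau> by (simp add: algebra_simps)
  then have "q / ?k \<le> q + \<epsilon>" using k by (simp add: pos_divide_le_eq)
  then have Y: "?Y \<le> \<delta>\<^sup>2 * (q + \<epsilon>)" using mult_left_mono[of "q / ?k" "q + \<epsilon>" "\<delta>\<^sup>2"] by simp
  have "\<delta> * g - \<delta> * \<eta> * N \<le> \<delta> * G" using mult_left_mono[OF G, of \<delta>] pos by (simp add: algebra_simps)
  then show ?thesis using quad lin1 lin2 Y by (simp add: field_simps)
qed

lemma dual_form_bounded:
  fixes V f :: "real ^ 'n \<Rightarrow> real"
  assumes V: "C2 V" and pd: "\<And>x. positive_definite (hessian V x)"
    and f: "C1 f" "compactly_supported f"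
  shows dual_form_continuous: "continuous_on UNIV (\<lambda>x. gradient f x \<bullet> (matrix_inv (hessian V x) *v gradient f x))"
    and "\<exists>B\<ge>0. \<forall>x. gradient f x \<bullet> (matrix_inv (hessian V x) *v gradient f x) \<le> B"
proof -
  let ?q = "\<lambda>x. gradient f x \<bullet> (matrix_inv (hessian V x) *v gradient f x)"
  let ?K = "closure {x. f x \<noteq> 0}"
  show cont: "continuous_on UNIV ?q"
    using V f pd
    by (intro continuous_intros continuous_on_matrix_inv_mult_vector positive_definite_invertible)
       (auto simp: C1_def C2_def)
  have "compact (?q ` ?K)"
    using f by (intro compact_continuous_image continuous_on_subset[OF cont]) (auto simp: compactly_supported_def)
  then obtain B where B: "\<And>x. x \<in> ?K \<Longrightarrow> \<bar>?q x\<bar> \<le> B"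
    using compact_imp_bounded bounded_iff by (metis (no_types, lifting) image_eqI real_norm_def)
  show "\<exists>B\<ge>0. \<forall>x. ?q x \<le> B"
  proof (intro exI[of _ "max 0 B"] conjI allI)
    fix x show "?q x \<le> max 0 B"
    proof (cases "x \<in> ?K")
      case True then show ?thesis using B[of x] by linarith
    next
      case False then show ?thesis by (simp add: gradient_zero_off_support)
    qed
  qed simp
qed

lemma C1_compact_support_bounded:
  assumes "C1 f" "compactly_supported f"
  obtains M where "0 < M" "\<And>x. \<bar>f x\<bar> \<le> M"
proof -
  let ?K = "closure {x. f x \<noteq> 0}"
  have "continuous_on UNIV f" using assms by (simp add: C1_def differentiable_imp_continuous_on)
  then have "compact (f ` ?K)"
    using assms by (intro compact_continuous_image) (auto simp: compactly_supported_def intro: continuous_on_subset)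
  then obtain B where B: "\<And>x. x \<in> ?K \<Longrightarrow> \<bar>f x\<bar> \<le> B"
    using compact_imp_bounded bounded_iff by (metis (no_types, lifting) image_eqI real_norm_def)
  show ?thesis
  proof (rule that[of "max 1 B"])
    fix x show "\<bar>f x\<bar> \<le> max 1 B"
      using B[of x] compactly_supported_zero[of x f] by (cases "x \<in> ?K") auto
  qed simp
qed

text \<open>
  For \<open>f = 0\<close> this is convexity of the perspective \<open>(s, y) \<mapsto> s * V (y / s)\<close>. With
  the perturbation, the excess of the right-hand side over \<open>V z\<close> is to second order the expression
  minimized in \<open>near_midpoint_estimate\<close>, whose infimum is \<open>- \<delta>\<^sup>2 / 2\<close> times the dual form.

  Both weighted differences to the tangent of \<open>V\<close> at \<open>z\<close> are Bregman divergences, the linear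
  terms cancelling since \<open>z\<close> is the weighted midpoint. Three cases arise. If \<open>f\<close> vanishes at
  both points, nonnegativity suffices. If both are close to \<open>z\<close> and one is in the support,
  everything happens in a fixed compact set and the local estimate applies uniformly. If one is
  in the support and the points are far apart, then its divergence exceeds a positive constant,
  which dominates the perturbation of order \<open>\<delta>\<close>.
\<close>

lemma perturbed_midpoint_convexity:
  fixes V f :: "real ^ 'n \<Rightarrow> real"
  assumes V: "C2 V" and pd: "\<And>x. positive_definite (hessian V x)"
    and f: "C1 f" "compactly_supported f" and \<epsilon>: "0 < \<epsilon>"
  obtains \<delta>0 where "0 < \<delta>0"
    "\<And>\<delta> x y z. 0 < \<delta> \<Longrightarrow> \<delta> < \<delta>0 \<Longrightarrow> z = (1 / 2) *\<^sub>R ((1 + c * \<delta>) *\<^sub>R x + (1 - c * \<delta>) *\<^sub>R y) \<Longrightarrow>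
      V z - \<delta>\<^sup>2 * ((gradient f z \<bullet> (matrix_inv (hessian V z) *v gradient f z)) / 2 + \<epsilon>)
      \<le> (1 / 2) * ((1 + c * \<delta>) * V x + (1 - c * \<delta>) * V y + \<delta> * (f x - f y))"
proof -
  let ?q = "\<lambda>x. gradient f x \<bullet> (matrix_inv (hessian V x) *v gradient f x)"
  let ?K = "closure {x. f x \<noteq> 0}"
  obtain B where B: "0 \<le> B" "\<And>x. ?q x \<le> B" using dual_form_bounded(2)[OF V pd f] by blast
  obtain M where M: "0 < M" "\<And>x. \<bar>f x\<bar> \<le> M" using C1_compact_support_bounded[OF f] by blast
  \<comment> \<open>Radius 2: midpoints at distance at most 1 from the support, and Taylor points at distance at most 1 from those.\<close>
  define K2 where "K2 = {x + y | x y. x \<in> ?K \<and> y \<in> cball 0 2}"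
  have K2: "compact K2" unfolding K2_def
    using f(2) by (intro compact_sums) (auto simp: compactly_supported_def)
  have inK2: "w \<in> K2" if "p \<in> ?K" "dist w p \<le> 2" for w p
    unfolding K2_def mem_Collect_eq
  proof (intro exI conjI)
    show "w = p + (w - p)" by simp
    show "w - p \<in> cball 0 2" using that(2) by (simp add: dist_norm norm_minus_commute)
  qed (rule that(1))
  obtain l where l: "0 < l" "\<And>z d. z \<in> K2 \<Longrightarrow> l * (norm d)\<^sup>2 \<le> d \<bullet> (hessian V z *v d)"
    using hessian_form_lower_bound[OF V pd K2] by blast
  \<comment> \<open>Chosen so that \<open>2 * \<tau> * (B + \<epsilon>) \<le> \<epsilon>\<close> and \<open>\<tau> \<le> 1 / 4\<close>.\<close>
  define \<tau> where "\<tau> = \<epsilon> / (4 * (B + \<epsilon>))"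
  have \<tau>: "0 < \<tau>" "\<tau> \<le> 1 / 4" using \<epsilon> B by (auto simp: \<tau>_def field_simps)
  have \<tau>q: "2 * \<tau> * (?q z + \<epsilon>) \<le> \<epsilon>" for z
  proof -
    have "2 * \<tau> * (?q z + \<epsilon>) \<le> 2 * \<tau> * (B + \<epsilon>)" using B(2)[of z] \<tau> by (intro mult_left_mono) auto
    also have "\<dots> \<le> \<epsilon>" using \<epsilon> B(1) by (simp add: \<tau>_def field_simps)
    finally show ?thesis .
  qed
  define \<eta> where "\<eta> = sqrt (\<epsilon> * \<tau> * l)"
  have \<eta>: "0 < \<eta>" "\<eta>\<^sup>2 = \<epsilon> * \<tau> * l" using \<epsilon> \<tau> l(1) by (auto simp: \<eta>_def)
  obtain r1 where r1: "0 < r1" "\<And>z w d. z \<in> K2 \<Longrightarrow> w \<in> K2 \<Longrightarrow> dist w z < r1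
      \<Longrightarrow> (1 - \<tau> / 2) * (d \<bullet> (hessian V z *v d)) \<le> d \<bullet> (hessian V w *v d)"
    using hessian_form_uniformly_continuous[OF V pd K2 half_gt_zero[OF \<tau>(1)]] by blast
  have "uniformly_continuous_on K2 (gradient f)"
    using f K2 by (intro compact_uniformly_continuous) (auto simp: C1_def intro: continuous_on_subset)
  then obtain r2 where r2: "0 < r2" "\<And>z w. z \<in> K2 \<Longrightarrow> w \<in> K2 \<Longrightarrow> dist w z < r2
      \<Longrightarrow> dist (gradient f w) (gradient f z) < \<eta>"
    unfolding uniformly_continuous_on_def using \<eta>(1) by blast
  define r where "r = min 1 (min r1 r2)"
  have r: "0 < r" "r \<le> 1" "r \<le> r1" "r \<le> r2" using r1(1) r2(1) by (auto simp: r_def)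
  \<comment> \<open>The first bound keeps the weights near 1. The second makes \<open>\<delta> * M\<close> smaller than the divergence of points at distance \<open>r / 3\<close>.\<close>
  define \<delta>0 where "\<delta>0 = min (\<tau> / (2 * (\<bar>c\<bar> + 1))) (l * r\<^sup>2 / (72 * M))"
  have \<delta>0: "0 < \<delta>0" using \<tau> l(1) r(1) M(1) by (auto simp: \<delta>0_def)
  show ?thesis
  proof (rule that[OF \<delta>0])
    fix \<delta> :: real and x y z :: "real ^ 'n"
    assume \<delta>: "0 < \<delta>" "\<delta> < \<delta>0" and z: "z = (1 / 2) *\<^sub>R ((1 + c * \<delta>) *\<^sub>R x + (1 - c * \<delta>) *\<^sub>R y)"
    define \<sigma> where "\<sigma> = c * \<delta>"
    have "\<bar>\<sigma>\<bar> \<le> (\<bar>c\<bar> + 1) * \<delta>" using \<delta> by (simp add: \<sigma>_def abs_mult mult_right_mono)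
    also have "\<dots> \<le> (\<bar>c\<bar> + 1) * (\<tau> / (2 * (\<bar>c\<bar> + 1)))" using \<delta> by (intro mult_left_mono) (auto simp: \<delta>0_def)
    also have "\<dots> = \<tau> / 2" by (simp add: field_simps)
    finally have \<sigma>: "\<bar>\<sigma>\<bar> \<le> \<tau> / 2" .
    then have \<sigma>2: "\<bar>\<sigma>\<bar> \<le> 1 / 2" using \<tau> by simp
    have \<delta>M: "\<delta> * M \<le> l * r\<^sup>2 / 72"
    proof -
      have "\<delta> * M \<le> l * r\<^sup>2 / (72 * M) * M" using \<delta> M(1) by (intro mult_right_mono) (auto simp: \<delta>0_def)
      then show ?thesis using M(1) by simp
    qed
    have z': "z = (1 / 2) *\<^sub>R ((1 + \<sigma>) *\<^sub>R x + (1 - \<sigma>) *\<^sub>R y)" using z by (simp add: \<sigma>_def)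
    let ?d = "x - y"
    have xz: "x - z = ((1 - \<sigma>) / 2) *\<^sub>R ?d" and yz: "y - z = - (((1 + \<sigma>) / 2) *\<^sub>R ?d)"
      by (simp_all add: z' vec_eq_iff field_simps)
    have dxz: "dist x z = (1 - \<sigma>) / 2 * norm ?d" and dyz: "dist y z = (1 + \<sigma>) / 2 * norm ?d"
      unfolding dist_norm xz yz using \<sigma>2 by (simp_all del: norm_scaleR add: norm_scaleR)
    have id: "(1 / 2) * ((1 + \<sigma>) * V x + (1 - \<sigma>) * V y + \<delta> * (f x - f y)) - V z
      = (1 / 2) * ((1 + \<sigma>) * bregman V x z + (1 - \<sigma>) * bregman V y z + \<delta> * (f x - f y))"
      unfolding bregman_def xz yz inner_minus_right inner_scaleR_right by (simp add: field_simps)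
    have br: "0 \<le> bregman V x z" "0 \<le> bregman V y z" using bregman_nonneg[OF V pd] by auto
    have q: "0 \<le> ?q z" by (rule dual_form_nonneg[OF pd])
    have "- \<delta>\<^sup>2 * (?q z / 2 + \<epsilon>)
      \<le> (1 / 2) * ((1 + \<sigma>) * bregman V x z + (1 - \<sigma>) * bregman V y z + \<delta> * (f x - f y))" (is "?L \<le> ?R")
    proof -
      have L: "?L \<le> 0" using q \<epsilon> by (simp add: mult_nonneg_nonneg)
      consider "x \<notin> ?K" "y \<notin> ?K" | p where "p \<in> ?K" "p = x \<or> p = y" "dist x z < r" "dist y z < r"
        | p where "p \<in> ?K" "p = x \<or> p = y" "r \<le> dist x z \<or> r \<le> dist y z"
        unfolding not_less[symmetric] by blast
      then show ?thesis
      proof cases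
        case 1
        then have "f x = 0" "f y = 0" using compactly_supported_zero by blast+
        then have "0 \<le> ?R" using br \<sigma>2 by simp
        then show ?thesis using L by linarith
      next
        case (2 p)
        have near: "w \<in> K2" if "dist w z < r" for w
          using inK2[OF 2(1), of w] 2 that r(2) dist_triangle[of w p z] dist_commute[of p z] by fastforce
        have zK: "z \<in> K2" using near r(1) by simp
        have seg: "dist w z < r" if "w \<in> closed_segment a b" "dist a z < r" "dist b z < r" for w a b
          using closed_segment_subset[of a "ball z r" b] that by (auto simp: dist_commute)
        obtain w1 where w1: "w1 \<in> closed_segment z x" "bregman V x z = (1 / 2) * ((x - z) \<bullet> (hessian V w1 *v (x - z)))"
          by (rule bregman_taylor[OF V])
        obtain w2 where w2: "w2 \<in> closed_segment z y" "bregman V y z = (1 / 2) * ((y - z) \<bullet> (hessian V w2 *v (y - z)))"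
          by (rule bregman_taylor[OF V])
        obtain w3 where w3: "w3 \<in> closed_segment y x" "f x - f y = gradient f w3 \<bullet> ?d"
          by (rule C1_mvt[OF f(1)])
        have d: "dist w1 z < r" "dist w2 z < r" "dist w3 z < r"
          using seg[OF w1(1)] seg[OF w2(1)] seg[OF w3(1)] 2 r(1) by auto
        have "norm (gradient f z - gradient f w3) \<le> \<eta>"
          using r2(2)[OF zK near, of w3] d(3) r(4) by (simp add: dist_norm norm_minus_commute)
        then have "(gradient f z - gradient f w3) \<bullet> ?d \<le> \<eta> * norm ?d"
          by (meson norm_cauchy_schwarz mult_right_mono norm_ge_zero order_trans)
        then have G: "gradient f z \<bullet> ?d - \<eta> * norm ?d \<le> gradient f w3 \<bullet> ?d" by (simp add: inner_diff_left)
        have "?L \<le> (1 / 2) * ((1 + \<sigma>) * (1 - \<sigma>)\<^sup>2 / 8 * (?d \<bullet> (hessian V w1 *v ?d))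
            + (1 - \<sigma>) * (1 + \<sigma>)\<^sup>2 / 8 * (?d \<bullet> (hessian V w2 *v ?d)) + \<delta> * (gradient f w3 \<bullet> ?d))"
        proof (rule near_midpoint_estimate[OF \<tau> \<epsilon> \<delta>(1) l(1) q _ norm_ge_zero \<tau>q \<eta>(2) \<sigma> l(2)[OF zK] _ _ _ G])
          show "0 \<le> ?d \<bullet> (hessian V z *v ?d)" using l(2)[OF zK, of ?d] l(1) by (meson mult_nonneg_nonneg less_imp_le order_trans zero_le_power2)
          show "(1 - \<tau> / 2) * (?d \<bullet> (hessian V z *v ?d)) \<le> ?d \<bullet> (hessian V w1 *v ?d)"
            using d r by (intro r1(2) zK near) auto
          show "(1 - \<tau> / 2) * (?d \<bullet> (hessian V z *v ?d)) \<le> ?d \<bullet> (hessian V w2 *v ?d)"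
            using d r by (intro r1(2) zK near) auto
          show "(gradient f z \<bullet> ?d)\<^sup>2 \<le> ?q z * (?d \<bullet> (hessian V z *v ?d))"
            by (rule dual_form_Cauchy_Schwarz[OF pd hessian_symmetric[OF V]])
        qed
        also have "\<dots> = ?R"
          unfolding w1(2) w2(2) w3(2) xz yz
          by (simp add: matrix_vector_mult_scaleR vec.neg power2_eq_square)
        finally show ?thesis .
      next
        case (3 p)
        have "3 * dist p z \<ge> r"
        proof -
          have "(1 - \<sigma>) * norm ?d \<le> 3 * (1 + \<sigma>) * norm ?d" "(1 + \<sigma>) * norm ?d \<le> 3 * (1 - \<sigma>) * norm ?d"
            "0 \<le> (1 + \<sigma>) * norm ?d" "0 \<le> (1 - \<sigma>) * norm ?d"
            using \<sigma>2 by (auto intro!: mult_right_mono mult_nonneg_nonneg)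
          moreover have "dist p z = (1 - \<sigma>) / 2 * norm ?d \<or> dist p z = (1 + \<sigma>) / 2 * norm ?d"
            using 3(2) dxz dyz by blast
          ultimately show ?thesis using 3(3) unfolding dxz dyz by (elim disjE; argo)
        qed
        then have far: "r / 3 \<le> dist p z" by simp
        have bp: "l * (r / 3)\<^sup>2 / 2 \<le> bregman V p z"
        proof (rule bregman_far[OF V pd _ far])
          show "l * (norm d)\<^sup>2 \<le> d \<bullet> (hessian V w *v d)" if "w \<in> cball p (r / 3)" for w d
            using that r by (intro l(2) inK2[OF 3(1)]) (auto simp: dist_commute)
        qed (use r in auto)
        have "bregman V p z / 2 \<le> (1 + \<sigma>) * bregman V x z + (1 - \<sigma>) * bregman V y z"
        proof -
          have "bregman V x z / 2 \<le> (1 + \<sigma>) * bregman V x z" "bregman V y z / 2 \<le> (1 - \<sigma>) * bregman V y z"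
            using mult_right_mono[OF _ br(1), of "1/2" "1 + \<sigma>"] mult_right_mono[OF _ br(2), of "1/2" "1 - \<sigma>"] \<sigma>2 by auto
          then show ?thesis using 3(2) br by auto
        qed
        moreover have "- (2 * (\<delta> * M)) \<le> \<delta> * (f x - f y)"
        proof -
          have "- (2 * M) \<le> f x - f y" using M(2)[of x] M(2)[of y] by linarith
          from mult_left_mono[OF this less_imp_le[OF \<delta>(1)]] show ?thesis by argo
        qed
        ultimately have "0 \<le> ?R" using bp \<delta>M by (simp add: power_divide)
        then show ?thesis using L by linarith
      qed
    qed
    then show "V z - \<delta>\<^sup>2 * (?q z / 2 + \<epsilon>)
      \<le> (1 / 2) * ((1 + c * \<delta>) * V x + (1 - c * \<delta>) * V y + \<delta> * (f x - f y))"
      using id unfolding \<sigma>_def by linarith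
  qed
qed

section \<open>Moments of log-concave measures\<close>

lemma nn_integral_lborel_scaleR:
  fixes f :: "'a::euclidean_space \<Rightarrow> ennreal"
  assumes [measurable]: "f \<in> borel_measurable borel" and s: "0 < s"
  shows "(\<integral>\<^sup>+x. f x \<partial>lborel) = ennreal (s ^ DIM('a)) * (\<integral>\<^sup>+x. f (s *\<^sub>R x) \<partial>lborel)"
proof -
  have "(\<integral>\<^sup>+x. f x \<partial>lborel) = (\<integral>\<^sup>+x. f x \<partial>density (distr lborel borel (\<lambda>x. 0 + s *\<^sub>R x)) (\<lambda>_. \<bar>s\<bar> ^ DIM('a)))"
    using lborel_affine[of s "0::'a"] s by simp
  also have "\<dots> = ennreal (s ^ DIM('a)) * (\<integral>\<^sup>+x. f (s *\<^sub>R x) \<partial>lborel)"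
    using s by (simp add: nn_integral_density nn_integral_distr nn_integral_cmult)
  finally show ?thesis .
qed

text \<open>
  If \<open>V\<close> is at most \<open>B\<close> on the unit ball, then midpoint convexity bounds it by
  \<open>(V x + B) / 2\<close> on the ball of radius \<open>1 / 2\<close> around \<open>x / 2\<close>. The volume of this ball does not
  depend on \<open>x\<close>, so a very negative value \<open>V x\<close> would make the integral exceed 1.
\<close>

lemma midpoint_convex_bounded_below:
  fixes V :: "'a::euclidean_space \<Rightarrow> real"
  assumes cont: "continuous_on UNIV V"
    and mid: "\<And>x y. V ((1 / 2) *\<^sub>R (x + y)) \<le> (V x + V y) / 2"
    and int: "(\<integral>\<^sup>+x. ennreal (exp (- V x)) \<partial>lborel) \<le> 1"
  obtains m where "\<And>x. - m \<le> V x"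
proof -
  have [measurable]: "V \<in> borel_measurable borel" using cont by (rule borel_measurable_continuous_onI)
  have "compact (V ` cball 0 1)" by (intro compact_continuous_image continuous_on_subset[OF cont]) auto
  then obtain B where B: "\<And>u. u \<in> cball 0 1 \<Longrightarrow> \<bar>V u\<bar> \<le> B"
    using compact_imp_bounded bounded_iff by (metis (no_types, lifting) image_eqI real_norm_def)
  define k where "k = unit_ball_vol (real DIM('a)) * (1 / 2) ^ DIM('a)"
  have k: "0 < k" by (simp add: k_def unit_ball_vol_pos)
  show ?thesis
  proof (rule that[of "B - 2 * ln k"])
    fix x
    let ?S = "cball ((1 / 2) *\<^sub>R x) (1 / 2)" and ?e = "exp (- ((V x + B) / 2))"
    have S: "V w \<le> (V x + B) / 2" if w: "w \<in> ?S" for w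
    proof -
      let ?u = "2 *\<^sub>R w - x"
      have "?u = 2 *\<^sub>R (w - (1 / 2) *\<^sub>R x)" by (simp add: algebra_simps)
      then have "norm ?u = 2 * dist ((1 / 2) *\<^sub>R x) w" by (simp only: norm_scaleR dist_norm) (simp add: norm_minus_commute)
      then have "?u \<in> cball 0 1" using w by simp
      then show ?thesis using mid[of x ?u] B[of ?u] by simp
    qed
    have "ennreal (?e * k) = (\<integral>\<^sup>+w. ennreal ?e * indicator ?S w \<partial>lborel)"
      using k by (subst nn_integral_cmult_indicator) (simp_all add: emeasure_cball k_def ennreal_mult)
    also have "\<dots> \<le> (\<integral>\<^sup>+x. ennreal (exp (- V x)) \<partial>lborel)"
    proof (rule nn_integral_mono)
      fix w
      have "?e \<le> exp (- V w)" if "w \<in> ?S" using S[OF that] by simp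
      then show "ennreal ?e * indicator ?S w \<le> ennreal (exp (- V w))"
        by (cases "w \<in> ?S") (simp_all add: ennreal_leI)
    qed
    also have "\<dots> \<le> 1" by (rule int)
    finally have "?e * k \<le> 1" by simp
    then have "ln (?e * k) \<le> 0" using k by (simp add: ln_le_zero_iff)
    then have "- ((V x + B) / 2) + ln k \<le> 0" using k by (simp add: ln_mult)
    then show "- (B - 2 * ln k) \<le> V x" by (simp add: field_simps)
  qed
qed

text \<open>
  Convexity between \<open>x\<close> and 0 bounds \<open>- V x / 2\<close> by \<open>- V (x / 2)\<close> up to a constant, and a
  dilation changes the integral of \<open>exp (- V)\<close> only by a factor.
\<close>

lemma nn_integral_exp_half_finite:
  fixes V :: "'a::euclidean_space \<Rightarrow> real"
  assumes [measurable]: "V \<in> borel_measurable borel"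
    and mid: "\<And>x y. V ((1 / 2) *\<^sub>R (x + y)) \<le> (V x + V y) / 2"
    and int: "(\<integral>\<^sup>+x. ennreal (exp (- V x)) \<partial>lborel) < \<infinity>"
  shows "(\<integral>\<^sup>+x. ennreal (exp (- V x / 2)) \<partial>lborel) < \<infinity>"
proof -
  let ?I = "\<lambda>s. \<integral>\<^sup>+x. ennreal (exp (- V (s *\<^sub>R x))) \<partial>lborel"
  have "ennreal ((1 / 2) ^ DIM('a)) * ?I (1 / 2) = ?I 1"
    using nn_integral_lborel_scaleR[of "\<lambda>x. ennreal (exp (- V x))" "1 / 2"] by simp
  then have "ennreal ((1 / 2) ^ DIM('a)) * ?I (1 / 2) < \<infinity>" using int by simp
  then have half: "?I (1 / 2) < \<infinity>" by (auto simp: ennreal_mult_less_top)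
  have "(\<integral>\<^sup>+x. ennreal (exp (- V x / 2)) \<partial>lborel)
      \<le> (\<integral>\<^sup>+x. ennreal (exp (V 0 / 2)) * ennreal (exp (- V ((1 / 2) *\<^sub>R x))) \<partial>lborel)"
  proof (rule nn_integral_mono)
    fix x
    have "- V x / 2 \<le> V 0 / 2 + - V ((1 / 2) *\<^sub>R x)" using mid[of x 0] by (simp add: field_simps)
    then show "ennreal (exp (- V x / 2)) \<le> ennreal (exp (V 0 / 2)) * ennreal (exp (- V ((1 / 2) *\<^sub>R x)))"
      by (simp add: ennreal_leI flip: ennreal_mult exp_add)
  qed
  also have "\<dots> = ennreal (exp (V 0 / 2)) * ?I (1 / 2)" by (rule nn_integral_cmult) measurable
  also have "\<dots> < \<infinity>" using half by (simp add: ennreal_mult_less_top)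
  finally show ?thesis .
qed

lemma C2_midpoint_convex:
  assumes V: "C2 V" and pd: "\<And>x. positive_definite (hessian V x)"
  shows "V ((1 / 2) *\<^sub>R (x + y)) \<le> (V x + V y) / 2"
proof -
  let ?z = "(1 / 2) *\<^sub>R (x + y)"
  have "(x - ?z) + (y - ?z) = 0" by (simp add: vec_eq_iff field_simps)
  then have "gradient V ?z \<bullet> (x - ?z) + gradient V ?z \<bullet> (y - ?z) = 0"
    by (metis inner_add_right inner_zero_right)
  moreover have "0 \<le> bregman V x ?z" "0 \<le> bregman V y ?z" using bregman_nonneg[OF V pd] by auto
  ultimately show ?thesis unfolding bregman_def by argo
qed

text \<open>
  Write \<open>W\<close> for \<open>V\<close> shifted to be nonnegative. Then \<open>(1 + W) ^ 3\<close> is at most a multiple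
  of \<open>exp (W / 2)\<close>, which uses up half of the decay of \<open>exp (- V)\<close>. Degree three is what the lower
  Taylor bound of the exponential requires.
\<close>

lemma integrable_cubic_growth:
  fixes V u :: "'a::euclidean_space \<Rightarrow> real"
  assumes [measurable]: "V \<in> borel_measurable borel" "u \<in> borel_measurable borel"
    and m: "\<And>x. - m \<le> V x"
    and half: "(\<integral>\<^sup>+x. ennreal (exp (- V x / 2)) \<partial>lborel) < \<infinity>"
    and u: "\<And>x. \<bar>u x\<bar> \<le> C * (1 + \<bar>V x\<bar>) ^ 3"
  shows "integrable (density lborel (\<lambda>x. ennreal (exp (- V x)))) u"
proof -
  let ?m = "max 0 m"
  have C: "0 \<le> C"
  proof (rule ccontr)
    assume "\<not> 0 \<le> C"
    then have "C * (1 + \<bar>V 0\<bar>) ^ 3 < 0" by (intro mult_neg_pos zero_less_power) auto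
    then show False using u[of 0] by linarith
  qed
  define D where "D = C * ((1 + ?m) * 6) ^ 3 * exp (?m / 2)"
  have bound: "\<bar>u x\<bar> * exp (- V x) \<le> D * exp (- V x / 2)" for x
  proof -
    define W where "W = V x + ?m"
    have W: "0 \<le> W" using m[of x] by (simp add: W_def)
    \<comment> \<open>Since \<open>1 + W \<le> 6 * exp (W / 6)\<close>, cubing gives \<open>exp (W / 2)\<close>.\<close>
    have "1 + \<bar>V x\<bar> \<le> 1 + W + ?m" using W by (simp add: W_def)
    also have "\<dots> \<le> (1 + ?m) * (1 + W)" using W by (simp add: algebra_simps)
    also have "\<dots> \<le> (1 + ?m) * (6 * exp (W / 6))"
    proof (rule mult_left_mono)
      show "1 + W \<le> 6 * exp (W / 6)" using exp_ge_add_one_self[of "W / 6"] by argo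
    qed simp
    finally have "(1 + \<bar>V x\<bar>) ^ 3 \<le> ((1 + ?m) * 6 * exp (W / 6)) ^ 3"
      by (intro power_mono) (simp only: mult.assoc, simp)
    also have "\<dots> = ((1 + ?m) * 6) ^ 3 * exp (W / 2)"
      by (simp add: power_mult_distrib flip: exp_of_nat_mult)
    finally have "C * (1 + \<bar>V x\<bar>) ^ 3 \<le> C * (((1 + ?m) * 6) ^ 3 * exp (W / 2))"
      by (rule mult_left_mono) (rule C)
    then have "\<bar>u x\<bar> \<le> C * ((1 + ?m) * 6) ^ 3 * exp (W / 2)" using u[of x] by simp
    then have "\<bar>u x\<bar> * exp (- V x) \<le> C * ((1 + ?m) * 6) ^ 3 * exp (W / 2) * exp (- V x)"
      by (rule mult_right_mono) simp
    also have "\<dots> = D * exp (- V x / 2)"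
      by (simp add: D_def W_def mult.assoc flip: exp_add)
    finally show ?thesis .
  qed
  have "integrable lborel (\<lambda>x. exp (- V x / 2))"
    using half by (intro integrableI_nonneg) auto
  then have "integrable lborel (\<lambda>x. D * exp (- V x / 2))" by simp
  then have "integrable lborel (\<lambda>x. exp (- V x) *\<^sub>R u x)"
    by (rule Bochner_Integration.integrable_bound)
       (use order_trans[OF bound abs_ge_self] in \<open>auto simp: abs_mult mult.commute\<close>)
  then show ?thesis by (subst integrable_density) auto
qed

section \<open>Second-order expansion of exponential moments\<close>

text \<open>
  Taylor polynomials of odd degree are global lower bounds of the exponential, as the
  remainder has even degree. The quadratic one would fail for negative arguments.
\<close>

lemma exp_ge_taylor3: "1 + t + t\<^sup>2 / 2 + t ^ 3 / 6 \<le> exp (t :: real)"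
proof -
  obtain s where "exp t = (\<Sum>m<4. t ^ m / fact m) + exp s / fact 4 * t ^ 4"
    using Maclaurin_exp_le[of t 4] by auto
  moreover have "0 \<le> exp s / fact 4 * t ^ 4" by simp
  ultimately show ?thesis by (simp add: eval_nat_numeral)
qed

text \<open>
  Compares the Bochner integral of a signed function with a nonnegative integral that may be
  infinite; \<open>ennreal\<close> sends a negative value on the left to 0.
\<close>

lemma ennreal_integral_le_nn_integral:
  assumes "integrable M T" "\<And>x. x \<in> space M \<Longrightarrow> T x \<le> u x"
  shows "ennreal (integral\<^sup>L M T) \<le> (\<integral>\<^sup>+x. ennreal (u x) \<partial>M)"
proof -
  have i: "integrable M (\<lambda>x. max 0 (T x))" using assms(1) by (intro integrable_max) auto
  have "ennreal (integral\<^sup>L M T) \<le> ennreal (\<integral>x. max 0 (T x) \<partial>M)"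
    by (intro ennreal_leI integral_mono assms(1) i) auto
  also have "\<dots> = (\<integral>\<^sup>+x. ennreal (max 0 (T x)) \<partial>M)"
    by (rule nn_integral_eq_integral[symmetric, OF i]) auto
  also have "\<dots> \<le> (\<integral>\<^sup>+x. ennreal (u x) \<partial>M)"
    using assms(2) by (intro nn_integral_mono) (auto simp: max_def ennreal_neg ennreal_leI)
  finally show ?thesis .
qed

lemma (in prob_space) exp_moment_lower_bound:
  assumes "integrable M g" "integrable M (\<lambda>x. (g x)\<^sup>2)" "integrable M (\<lambda>x. (g x) ^ 3)"
  shows "ennreal (1 - \<delta> * expectation g + \<delta>\<^sup>2 * expectation (\<lambda>x. (g x)\<^sup>2) / 2 - \<delta> ^ 3 * expectation (\<lambda>x. (g x) ^ 3) / 6)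
    \<le> (\<integral>\<^sup>+x. ennreal (exp (- \<delta> * g x)) \<partial>M)"
proof -
  let ?T = "\<lambda>x. 1 - \<delta> * g x + \<delta>\<^sup>2 / 2 * (g x)\<^sup>2 - \<delta> ^ 3 / 6 * (g x) ^ 3"
  have "integral\<^sup>L M ?T = 1 - \<delta> * expectation g + \<delta>\<^sup>2 * expectation (\<lambda>x. (g x)\<^sup>2) / 2 - \<delta> ^ 3 * expectation (\<lambda>x. (g x) ^ 3) / 6"
    using assms by (simp add: prob_space)
  moreover have "ennreal (integral\<^sup>L M ?T) \<le> (\<integral>\<^sup>+x. ennreal (exp (- \<delta> * g x)) \<partial>M)"
  proof (rule ennreal_integral_le_nn_integral)
    show "integrable M ?T" using assms by simp
    fix x show "?T x \<le> exp (- \<delta> * g x)"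
      using exp_ge_taylor3[of "- \<delta> * g x"] by (simp add: power_mult_distrib)
  qed
  ultimately show ?thesis by simp
qed

lemma (in prob_space) exp_moment_upper_bound:
  assumes [measurable]: "p \<in> borel_measurable M" and p: "\<And>x. 0 \<le> p x" "\<And>x. p x \<le> B" and u: "0 \<le> u" "u * B \<le> 1"
  shows "(\<integral>\<^sup>+x. ennreal (exp (u * p x)) \<partial>M) \<le> ennreal (1 + u * expectation p + u\<^sup>2 * B\<^sup>2)"
proof -
  have i: "integrable M p"
    by (rule integrable_const_bound[of _ B]) (use p in \<open>auto intro!: always_eventually\<close>)
  have le: "exp (u * p x) \<le> 1 + u * p x + u\<^sup>2 * B\<^sup>2" for x
  proof -
    have b: "u * p x \<le> u * B" using p u by (intro mult_left_mono) auto
    have "exp (u * p x) \<le> 1 + u * p x + (u * p x)\<^sup>2"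
      using b u p by (intro exp_bound) auto
    moreover have "(u * p x)\<^sup>2 \<le> (u * B)\<^sup>2" using b u p by (intro power_mono) auto
    ultimately show ?thesis by (simp add: power_mult_distrib)
  qed
  have "(\<integral>\<^sup>+x. ennreal (exp (u * p x)) \<partial>M) \<le> (\<integral>\<^sup>+x. ennreal (1 + u * p x + u\<^sup>2 * B\<^sup>2) \<partial>M)"
    by (intro nn_integral_mono ennreal_leI le)
  also have "\<dots> = ennreal (\<integral>x. 1 + u * p x + u\<^sup>2 * B\<^sup>2 \<partial>M)"
    using i u p by (intro nn_integral_eq_integral) (auto intro!: always_eventually)
  also have "(\<integral>x. 1 + u * p x + u\<^sup>2 * B\<^sup>2 \<partial>M) = 1 + u * expectation p + u\<^sup>2 * B\<^sup>2"
    using i by (simp add: prob_space)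
  finally show ?thesis .
qed

text \<open>
  Both sides equal 1 at \<open>u = 0\<close>, so the inequality to the right of 0 carries over to their
  derivatives there, which are \<open>S - E\<^sup>2 - n * k\<close> and \<open>2 * a\<close>.
\<close>

lemma first_order_comparison:
  fixes a k S E T K :: real
  assumes u0: "0 < u0"
    and le: "\<And>u. 0 < u \<Longrightarrow> u < u0 \<Longrightarrow>
      (1 - k * u) ^ n * ((1 + u * S / 2)\<^sup>2 - u * (E + u * T / 6)\<^sup>2) \<le> (1 + u * a + u\<^sup>2 * K)\<^sup>2"
  shows "S - E\<^sup>2 - n * k \<le> 2 * a"
proof (rule ccontr)
  assume neg: "\<not> ?thesis"
  let ?D = "\<lambda>u. (1 + u * a + u\<^sup>2 * K)\<^sup>2 - (1 - k * u) ^ n * ((1 + u * S / 2)\<^sup>2 - u * (E + u * T / 6)\<^sup>2)"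
  have "(?D has_real_derivative 2 * a - (S - E\<^sup>2 - n * k)) (at 0)"
    by (auto intro!: derivative_eq_intros simp: algebra_simps)
  then obtain d where d: "0 < d" "\<And>h. 0 < h \<Longrightarrow> h < d \<Longrightarrow> ?D (0 + h) < ?D 0"
    using DERIV_neg_dec_right[of ?D "2 * a - (S - E\<^sup>2 - n * k)" 0] neg by auto
  have "0 < min d u0 / 2" "min d u0 / 2 < d" "min d u0 / 2 < u0" using d(1) u0 by auto
  then show False using d(2)[of "min d u0 / 2"] le[of "min d u0 / 2"] by simp
qed

section \<open>The variance inequality\<close>

lemma C2_continuous:
  assumes "C2 V"
  shows "continuous_on UNIV V"
  using assms by (simp add: C1_def C2_def differentiable_imp_continuous_on)

lemma log_concave_integrable:
  fixes V u :: "real ^ 'n \<Rightarrow> real"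
  assumes V: "C2 V" and pd: "\<And>x. positive_definite (hessian V x)"
    and \<mu>: "\<mu> = density lborel (\<lambda>x. ennreal (exp (- V x)))" and P: "prob_space \<mu>"
    and u: "u \<in> borel_measurable borel" "\<And>x. \<bar>u x\<bar> \<le> C * (1 + \<bar>V x\<bar>) ^ 3"
  shows "integrable \<mu> u"
proof -
  have [measurable]: "V \<in> borel_measurable borel"
    by (rule borel_measurable_continuous_onI[OF C2_continuous[OF V]])
  have total: "(\<integral>\<^sup>+x. ennreal (exp (- V x)) \<partial>lborel) = 1"
    using prob_space.emeasure_space_1[OF P] unfolding \<mu> by (simp add: emeasure_density)
  obtain m where m: "\<And>x. - m \<le> V x"
    using midpoint_convex_bounded_below[OF C2_continuous[OF V] C2_midpoint_convex[OF V pd]] total by auto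
  have "(\<integral>\<^sup>+x. ennreal (exp (- V x / 2)) \<partial>lborel) < \<infinity>"
    by (rule nn_integral_exp_half_finite[OF _ C2_midpoint_convex[OF V pd]]) (simp_all add: total)
  then show ?thesis unfolding \<mu> by (intro integrable_cubic_growth[OF _ u(1) m _ u(2)]) auto
qed

text \<open>
  The substitution \<open>y = (1 + c * \<delta>) x\<close> produces the dimensional factor and turns the integral
  into an exponential moment of \<open>f + c V\<close> under \<open>\<mu>\<close>.
\<close>

lemma perturbed_mass_lower_bound:
  fixes V f :: "real ^ 'n \<Rightarrow> real"
  assumes V: "V \<in> borel_measurable borel" and f: "f \<in> borel_measurable borel"
    and \<mu>: "\<mu> = density lborel (\<lambda>x. ennreal (exp (- V x)))" and P: "prob_space \<mu>"
    and s: "0 < 1 + c * \<delta>"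
    and int: "integrable \<mu> (\<lambda>x. f x + c * V x)" "integrable \<mu> (\<lambda>x. (f x + c * V x)\<^sup>2)"
      "integrable \<mu> (\<lambda>x. (f x + c * V x) ^ 3)"
  shows "ennreal ((1 + c * \<delta>) ^ CARD('n) * (1 - \<delta> * (\<integral>x. f x + c * V x \<partial>\<mu>)
      + \<delta>\<^sup>2 * (\<integral>x. (f x + c * V x)\<^sup>2 \<partial>\<mu>) / 2 - \<delta> ^ 3 * (\<integral>x. (f x + c * V x) ^ 3 \<partial>\<mu>) / 6))
    \<le> (\<integral>\<^sup>+y. ennreal (exp (- ((1 + c * \<delta>) * V ((1 / (1 + c * \<delta>)) *\<^sub>R y) + \<delta> * f ((1 / (1 + c * \<delta>)) *\<^sub>R y)))) \<partial>lborel)"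
    (is "ennreal (?s ^ _ * ?L) \<le> ?I")
proof -
  note [measurable] = V f
  have "?I = ennreal (?s ^ CARD('n)) * (\<integral>\<^sup>+x. ennreal (exp (- (?s * V x + \<delta> * f x))) \<partial>lborel)"
    using s by (subst nn_integral_lborel_scaleR[OF _ s]) (simp_all del: minus_add_distrib)
  also have "(\<integral>\<^sup>+x. ennreal (exp (- (?s * V x + \<delta> * f x))) \<partial>lborel)
      = (\<integral>\<^sup>+x. ennreal (exp (- \<delta> * (f x + c * V x))) \<partial>\<mu>)"
    unfolding \<mu> by (subst nn_integral_density) 
      (auto intro!: nn_integral_cong simp: algebra_simps simp flip: ennreal_mult exp_add)
  finally have I: "?I = ennreal (?s ^ CARD('n)) * (\<integral>\<^sup>+x. ennreal (exp (- \<delta> * (f x + c * V x))) \<partial>\<mu>)" .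
  have "ennreal (?s ^ CARD('n) * ?L) = ennreal (?s ^ CARD('n)) * ennreal ?L"
    using s by (simp add: ennreal_mult')
  also have "\<dots> \<le> ?I"
    unfolding I by (intro mult_left_mono prob_space.exp_moment_lower_bound[OF P int]) simp
  finally show ?thesis .
qed

text \<open>
  The inequality of Prekopa and Leindler is applied to the exponentials of
  \<open>- ((1 + c \<delta>) * V (y / (1 + c \<delta>)) + \<delta> * f (y / (1 + c \<delta>)))\<close> for \<open>\<delta>\<close> and \<open>- \<delta>\<close>. The hypothesis on
  midpoints is \<open>perturbed_midpoint_convexity\<close>. To second order in \<open>\<delta>\<close>, the product of the two
  integrals is \<open>1 + \<delta>\<^sup>2 * (Var \<mu> g - n * c\<^sup>2)\<close>, where the last term comes from
  \<open>((1 + c \<delta>) * (1 - c \<delta>)) ^ n\<close>, and the square of the integral at the midpoints is at most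
  \<open>1 + \<delta>\<^sup>2 * Q\<close>, with \<open>Q\<close> the integral of the dual form.
\<close>

lemma brascamp_lieb_quadratic:
  fixes V f :: "real ^ 'n \<Rightarrow> real"
  assumes P: "prob_space \<mu>" and \<mu>: "\<mu> = density lborel (\<lambda>x. ennreal (exp (- V x)))"
    and V: "C2 V" and pd: "\<And>x. positive_definite (hessian V x)"
    and f: "C1 f" "compactly_supported f"
    and g_def: "g = (\<lambda>x. f x + c * V x)"
    and int: "integrable \<mu> g" "integrable \<mu> (\<lambda>x. (g x)\<^sup>2)" "integrable \<mu> (\<lambda>x. (g x) ^ 3)"
  shows "Var \<mu> g - real CARD('n) * c\<^sup>2
    \<le> (\<integral>x. gradient f x \<bullet> (matrix_inv (hessian V x) *v gradient f x) \<partial>\<mu>)"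
proof -
  let ?q = "\<lambda>x. gradient f x \<bullet> (matrix_inv (hessian V x) *v gradient f x)"
  let ?E = "\<integral>x. g x \<partial>\<mu>" and ?S = "\<integral>x. (g x)\<^sup>2 \<partial>\<mu>" and ?T = "\<integral>x. (g x) ^ 3 \<partial>\<mu>" and ?Q = "\<integral>x. ?q x \<partial>\<mu>"
  interpret prob_space \<mu> by (rule P)
  have [measurable]: "V \<in> borel_measurable borel"
    by (rule borel_measurable_continuous_onI[OF C2_continuous[OF V]])
  have [measurable]: "f \<in> borel_measurable borel"
    using f(1) by (intro borel_measurable_continuous_onI) (simp add: C1_def differentiable_imp_continuous_on)
  have qm [measurable]: "?q \<in> borel_measurable borel"
    by (rule borel_measurable_continuous_onI[OF dual_form_continuous[OF V pd f]])
  have q0: "0 \<le> ?q x" for x by (rule dual_form_nonneg[OF pd])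
  obtain B where B: "0 \<le> B" "\<And>x. ?q x \<le> B" using dual_form_bounded(2)[OF V pd f] by blast
  have qi: "integrable \<mu> ?q"
    by (rule integrable_const_bound[of _ B]) (use q0 B in \<open>auto intro!: always_eventually simp: \<mu>\<close>)
  have "?S - ?E\<^sup>2 - real CARD('n) * c\<^sup>2 \<le> ?Q + e" if e: "0 < e" for e
  proof -
    define \<epsilon> where "\<epsilon> = e / 2"
    have \<epsilon>: "0 < \<epsilon>" using e by (simp add: \<epsilon>_def)
    obtain \<delta>0 where \<delta>0: "0 < \<delta>0"
      "\<And>\<delta> x y z. 0 < \<delta> \<Longrightarrow> \<delta> < \<delta>0 \<Longrightarrow> z = (1 / 2) *\<^sub>R ((1 + c * \<delta>) *\<^sub>R x + (1 - c * \<delta>) *\<^sub>R y) \<Longrightarrow>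
        V z - \<delta>\<^sup>2 * (?q z / 2 + \<epsilon>) \<le> (1 / 2) * ((1 + c * \<delta>) * V x + (1 - c * \<delta>) * V y + \<delta> * (f x - f y))"
      using perturbed_midpoint_convexity[OF V pd f \<epsilon>, of c] by blast
    let ?l = "\<lambda>\<delta>. 1 - \<delta> * ?E + \<delta>\<^sup>2 * ?S / 2 - \<delta> ^ 3 * ?T / 6"
    have "(?l \<longlongrightarrow> 1) (at 0)" by (auto intro!: tendsto_eq_intros)
    then have "\<forall>\<^sub>F \<delta> in at 0. 0 < ?l \<delta>" by (rule order_tendstoD(1)) simp
    then obtain \<delta>1 where \<delta>1: "0 < \<delta>1" "\<And>\<delta>. \<delta> \<noteq> 0 \<Longrightarrow> \<bar>\<delta>\<bar> < \<delta>1 \<Longrightarrow> 0 < ?l \<delta>"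
      by (auto simp: eventually_at dist_real_def)
    let ?B = "B / 2 + \<epsilon>"
    have Bp: "0 < ?B" using B \<epsilon> by simp
    \<comment> \<open>The entries bound \<open>\<delta>\<close> by \<open>\<delta>0\<close> and \<open>\<delta>1\<close>, make both dilation factors positive, and keep the exponent in the upper bound at most 1.\<close>
    define u0 where "u0 = Min {1, \<delta>0\<^sup>2, \<delta>1\<^sup>2, 1 / (c\<^sup>2 + 1), 1 / ?B}"
    have u0: "0 < u0" using \<delta>0(1) \<delta>1(1) Bp
      by (auto simp: u0_def intro!: divide_pos_pos add_nonneg_pos)
    have "?S - ?E\<^sup>2 - real CARD('n) * c\<^sup>2 \<le> 2 * (?Q / 2 + \<epsilon>)"
    proof (rule first_order_comparison[OF u0])
      fix u assume u: "0 < u" "u < u0"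
      define \<delta> where "\<delta> = sqrt u"
      have \<delta>: "0 < \<delta>" "\<delta>\<^sup>2 = u" using u by (auto simp: \<delta>_def)
      have "\<delta>\<^sup>2 < \<delta>0\<^sup>2" "\<delta>\<^sup>2 < \<delta>1\<^sup>2" "\<delta>\<^sup>2 < 1 / (c\<^sup>2 + 1)" "\<delta>\<^sup>2 < 1 / ?B"
        using u \<delta>(2) by (auto simp: u0_def)
      then have lt: "\<delta> < \<delta>0" "\<delta> < \<delta>1" and "\<delta>\<^sup>2 * (c\<^sup>2 + 1) < 1" and uB: "u * ?B \<le> 1"
        using \<delta> \<delta>0(1) \<delta>1(1) Bp
        by (auto simp: pos_less_divide_eq add_nonneg_pos intro: power_less_imp_less_base)
      then have "(c * \<delta>)\<^sup>2 < 1\<^sup>2" using \<delta> u(1) by (simp add: power_mult_distrib algebra_simps)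
      then have "\<bar>c * \<delta>\<bar> < 1" by (simp only: one_power2 abs_square_less_1)
      then have s: "0 < 1 + c * \<delta>" "0 < 1 - c * \<delta>" by auto
      let ?F = "\<lambda>\<delta> y. ennreal (exp (- ((1 + c * \<delta>) * V ((1 / (1 + c * \<delta>)) *\<^sub>R y) + \<delta> * f ((1 / (1 + c * \<delta>)) *\<^sub>R y))))"
      let ?h = "\<lambda>z. ennreal (exp (- V z + u * (?q z / 2 + \<epsilon>)))"
      have PL: "(\<integral>\<^sup>+y. ?F \<delta> y \<partial>lborel) * (\<integral>\<^sup>+y. ?F (- \<delta>) y \<partial>lborel) \<le> (\<integral>\<^sup>+z. ?h z \<partial>lborel)\<^sup>2"
      proof (rule prekopa_leindler)
        fix y1 y2 :: "real ^ 'n"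
        define x where "x = (1 / (1 + c * \<delta>)) *\<^sub>R y1"
        define y where "y = (1 / (1 - c * \<delta>)) *\<^sub>R y2"
        let ?z = "(1 / 2) *\<^sub>R (y1 + y2)"
        have "?z = (1 / 2) *\<^sub>R ((1 + c * \<delta>) *\<^sub>R x + (1 - c * \<delta>) *\<^sub>R y)"
          using s by (simp add: x_def y_def)
        from \<delta>0(2)[OF \<delta>(1) lt(1) this]
        have "- ((1 + c * \<delta>) * V x + \<delta> * f x) + - ((1 - c * \<delta>) * V y - \<delta> * f y)
            \<le> 2 * (- V ?z + u * (?q ?z / 2 + \<epsilon>))"
          unfolding \<delta>(2) by argo
        then have "ennreal (exp (- ((1 + c * \<delta>) * V x + \<delta> * f x) + - ((1 - c * \<delta>) * V y - \<delta> * f y)))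
            \<le> ennreal (exp (2 * (- V ?z + u * (?q ?z / 2 + \<epsilon>))))"
          by (simp add: ennreal_leI)
        also have "\<dots> = (?h ?z)\<^sup>2"
          by (simp only: ennreal_power exp_ge_zero exp_double)
        finally show "?F \<delta> y1 * ?F (- \<delta>) y2 \<le> (?h ?z)\<^sup>2"
          by (simp add: exp_add ennreal_mult x_def y_def)
      qed measurable
      have "(\<integral>\<^sup>+z. ?h z \<partial>lborel) = (\<integral>\<^sup>+z. ennreal (exp (u * (?q z / 2 + \<epsilon>))) \<partial>\<mu>)"
        unfolding \<mu> by (subst nn_integral_density) (auto intro!: nn_integral_cong simp: algebra_simps simp flip: ennreal_mult exp_add)
      also have "\<dots> \<le> ennreal (1 + u * (\<integral>z. ?q z / 2 + \<epsilon> \<partial>\<mu>) + u\<^sup>2 * ?B\<^sup>2)"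
        using u(1) uB q0 B \<epsilon>
        by (intro exp_moment_upper_bound) (auto simp: \<mu> intro: add_nonneg_nonneg)
      also have "(\<integral>z. ?q z / 2 + \<epsilon> \<partial>\<mu>) = ?Q / 2 + \<epsilon>"
        using qi by (simp add: prob_space)
      finally have H: "(\<integral>\<^sup>+z. ?h z \<partial>lborel) \<le> ennreal (1 + u * (?Q / 2 + \<epsilon>) + u\<^sup>2 * ?B\<^sup>2)" .
      have lower: "ennreal ((1 + c * d) ^ CARD('n) * ?l d) \<le> (\<integral>\<^sup>+y. ?F d y \<partial>lborel)" if "0 < 1 + c * d" for d
        using perturbed_mass_lower_bound[OF _ _ \<mu> P that, of f] int unfolding g_def by simp
      have pos: "0 < ?l \<delta>" "0 < ?l (- \<delta>)" using \<delta>1(2)[of \<delta>] \<delta>1(2)[of "- \<delta>"] \<delta>(1) lt(2) by auto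
      have Q0: "0 \<le> ?Q" using q0 by (intro integral_nonneg_AE) simp
      have "ennreal (((1 + c * \<delta>) ^ CARD('n) * ?l \<delta>) * ((1 - c * \<delta>) ^ CARD('n) * ?l (- \<delta>)))
          = ennreal ((1 + c * \<delta>) ^ CARD('n) * ?l \<delta>) * ennreal ((1 - c * \<delta>) ^ CARD('n) * ?l (- \<delta>))"
        using pos s by (intro ennreal_mult) (auto intro!: mult_nonneg_nonneg simp del: minus_mult_left)
      also have "\<dots> \<le> (\<integral>\<^sup>+y. ?F \<delta> y \<partial>lborel) * (\<integral>\<^sup>+y. ?F (- \<delta>) y \<partial>lborel)"
        using lower[of \<delta>] lower[of "- \<delta>"] s by (intro mult_mono) auto
      also have "\<dots> \<le> (\<integral>\<^sup>+z. ?h z \<partial>lborel)\<^sup>2" by (rule PL)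
      also have "\<dots> \<le> (ennreal (1 + u * (?Q / 2 + \<epsilon>) + u\<^sup>2 * ?B\<^sup>2))\<^sup>2" by (rule power_mono[OF H]) simp
      also have "\<dots> = ennreal ((1 + u * (?Q / 2 + \<epsilon>) + u\<^sup>2 * ?B\<^sup>2)\<^sup>2)"
        using u(1) \<epsilon> Q0 by (intro ennreal_power) (auto intro!: add_nonneg_nonneg mult_nonneg_nonneg)
      finally have "((1 + c * \<delta>) ^ CARD('n) * ?l \<delta>) * ((1 - c * \<delta>) ^ CARD('n) * ?l (- \<delta>))
          \<le> (1 + u * (?Q / 2 + \<epsilon>) + u\<^sup>2 * ?B\<^sup>2)\<^sup>2"
        by (subst (asm) ennreal_le_iff) auto
      also have "((1 + c * \<delta>) ^ CARD('n) * ?l \<delta>) * ((1 - c * \<delta>) ^ CARD('n) * ?l (- \<delta>))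
          = ((1 + c * \<delta>) * (1 - c * \<delta>)) ^ CARD('n) * (?l \<delta> * ?l (- \<delta>))"
        by (simp only: power_mult_distrib mult_ac)
      also have "(1 + c * \<delta>) * (1 - c * \<delta>) = 1 - c\<^sup>2 * u"
        unfolding \<delta>(2)[symmetric] by (simp add: power2_eq_square algebra_simps)
      also have "?l \<delta> * ?l (- \<delta>) = (1 + u * ?S / 2)\<^sup>2 - u * (?E + u * ?T / 6)\<^sup>2"
        unfolding \<delta>(2)[symmetric] by (simp add: power2_eq_square power3_eq_cube algebra_simps)
      finally show "(1 - c\<^sup>2 * u) ^ CARD('n) * ((1 + u * ?S / 2)\<^sup>2 - u * (?E + u * ?T / 6)\<^sup>2)
          \<le> (1 + u * (?Q / 2 + \<epsilon>) + u\<^sup>2 * ?B\<^sup>2)\<^sup>2" .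
    qed
    then show ?thesis by (simp add: \<epsilon>_def)
  qed
  then have "?S - ?E\<^sup>2 - real CARD('n) * c\<^sup>2 \<le> ?Q" by (rule field_le_epsilon)
  then show ?thesis by (simp add: Var_def)
qed

theorem proposition4p1:
  fixes \<mu> :: "(real ^ 'n) measure" and V f :: "real ^ 'n \<Rightarrow> real"
  assumes "prob_space \<mu>"
    and "\<mu> = density lborel (\<lambda>x. ennreal (exp (- V x)))"
    and "C2 V"
    and "\<And>x. positive_definite (hessian V x)"
    and "C1 f"
    and "compactly_supported f"
  shows "Var \<mu> f \<le>
    (\<integral>x. gradient f x \<bullet> (matrix_inv (hessian V x) *v gradient f x) \<partial>\<mu>)
    - ((\<integral>x. V x * f x \<partial>\<mu>) - (\<integral>x. V x \<partial>\<mu>) * (\<integral>x. f x \<partial>\<mu>))\<^sup>2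
      / (real CARD('n) - Var \<mu> V)"
proof -
  let ?Q = "\<integral>x. gradient f x \<bullet> (matrix_inv (hessian V x) *v gradient f x) \<partial>\<mu>"
  let ?C = "(\<integral>x. V x * f x \<partial>\<mu>) - (\<integral>x. V x \<partial>\<mu>) * (\<integral>x. f x \<partial>\<mu>)"
  let ?k = "real CARD('n) - Var \<mu> V"
  note V = assms(3,4) and f = assms(5,6)
  have [measurable]: "V \<in> borel_measurable borel"
    by (rule borel_measurable_continuous_onI[OF C2_continuous[OF V(1)]])
  have [measurable]: "f \<in> borel_measurable borel"
    using f(1) by (intro borel_measurable_continuous_onI) (simp add: C1_def differentiable_imp_continuous_on)
  obtain M where M: "0 < M" "\<And>x. \<bar>f x\<bar> \<le> M"
    using C1_compact_support_bounded[OF f] by blast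
  note integrable = log_concave_integrable[OF V assms(2,1)]
  have growth: "\<bar>f x\<bar> ^ i * \<bar>V x\<bar> ^ j \<le> (1 + M) ^ 3 * (1 + \<bar>V x\<bar>) ^ 3" if "i \<le> 3" "j \<le> 3" for i j x
  proof (rule mult_mono)
    have "\<bar>f x\<bar> ^ i \<le> (1 + M) ^ i" using M(1) by (intro power_mono order_trans[OF M(2)]) auto
    also have "\<dots> \<le> (1 + M) ^ 3" using M that by (intro power_increasing) auto
    finally show "\<bar>f x\<bar> ^ i \<le> (1 + M) ^ 3" .
    have "\<bar>V x\<bar> ^ j \<le> (1 + \<bar>V x\<bar>) ^ j" by (intro power_mono) auto
    also have "\<dots> \<le> (1 + \<bar>V x\<bar>) ^ 3" using that by (intro power_increasing) auto
    finally show "\<bar>V x\<bar> ^ j \<le> (1 + \<bar>V x\<bar>) ^ 3" .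
  qed (use M in auto)
  have mono: "integrable \<mu> (\<lambda>x. f x ^ i * V x ^ j)" if "i \<le> 3" "j \<le> 3" for i j
    by (rule integrable[where C = "(1 + M) ^ 3"]) (use growth[OF that] in \<open>auto simp: abs_mult power_abs\<close>)
  \<comment> \<open>All monomials in \<open>f\<close> and \<open>V\<close> of degree at most three, as they occur in powers of \<open>f + c V\<close>.\<close>
  note m = mono[of 1 0] mono[of 0 1] mono[of 2 0] mono[of 1 1] mono[of 0 2]
    mono[of 3 0] mono[of 2 1] mono[of 1 2] mono[of 0 3]
  have key: "Var \<mu> f + 2 * c * ?C - c\<^sup>2 * ?k \<le> ?Q" for c
  proof -
    let ?g = "\<lambda>x. f x + c * V x"
    have g2: "(\<lambda>x. (?g x)\<^sup>2) = (\<lambda>x. (f x)\<^sup>2 + (2 * c) * (V x * f x) + c\<^sup>2 * (V x)\<^sup>2)"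
      by (auto simp: fun_eq_iff power2_eq_square algebra_simps)
    have g3: "(\<lambda>x. (?g x) ^ 3) = (\<lambda>x. f x ^ 3 + (3 * c) * ((f x)\<^sup>2 * V x) + (3 * c\<^sup>2) * (f x * (V x)\<^sup>2) + c ^ 3 * V x ^ 3)"
      by (auto simp: fun_eq_iff power2_eq_square power3_eq_cube algebra_simps)
    have i1: "integrable \<mu> ?g" and i2: "integrable \<mu> (\<lambda>x. (?g x)\<^sup>2)" and i3: "integrable \<mu> (\<lambda>x. (?g x) ^ 3)"
      using m unfolding g2 g3 by (simp_all add: mult.commute[of "V _" "f _"])
    have j: "integrable \<mu> f" "integrable \<mu> V" "integrable \<mu> (\<lambda>x. (f x)\<^sup>2)"
      "integrable \<mu> (\<lambda>x. V x * f x)" "integrable \<mu> (\<lambda>x. (V x)\<^sup>2)"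
      using m by (simp_all add: mult.commute[of "V _" "f _"])
    have "(\<integral>x. ?g x \<partial>\<mu>) = (\<integral>x. f x \<partial>\<mu>) + c * (\<integral>x. V x \<partial>\<mu>)"
      using j by simp
    moreover have "(\<integral>x. (?g x)\<^sup>2 \<partial>\<mu>)
        = (\<integral>x. (f x)\<^sup>2 \<partial>\<mu>) + 2 * c * (\<integral>x. V x * f x \<partial>\<mu>) + c\<^sup>2 * (\<integral>x. (V x)\<^sup>2 \<partial>\<mu>)"
      unfolding g2 using j by simp
    ultimately have "Var \<mu> ?g = Var \<mu> f + 2 * c * ?C + c\<^sup>2 * Var \<mu> V"
      unfolding Var_def by (simp add: power2_eq_square algebra_simps)
    then show ?thesis
      using brascamp_lieb_quadratic[OF assms(1-6) refl i1 i2 i3] by (simp add: algebra_simps)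
  qed
  show ?thesis
  proof (cases "0 < ?k")
    case True
    \<comment> \<open>The maximum over \<open>c\<close> of \<open>2 * c * a - c\<^sup>2 * k\<close> is attained at \<open>c = a / k\<close>.\<close>
    have opt: "2 * (a / k) * a - (a / k)\<^sup>2 * k = a\<^sup>2 / k" if "0 < k" for a k :: real
      using that by (simp add: power2_eq_square field_simps)
    show ?thesis using key[of "?C / ?k"] opt[OF True, of ?C] by linarith
  next
    case False
    \<comment> \<open>A nonpositive denominator makes the claim weaker than the case \<open>c = 0\<close>; this includes division by zero, whose value is 0.\<close>
    then have "?C\<^sup>2 / ?k \<le> 0" by (simp add: divide_nonneg_nonpos)
    then show ?thesis using key[of 0] by simp
  qed
qed

end
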